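(* Let $\mu=\omega$ or $\mu=\omega_1$ and let $\Sigma$ be a $\mu$-ary (discrete) signature. Then a class of quantitative $\Sigma$-algebras is a $\mu$-$\mathit{Surj}$-Birkhoff subcategory of $\mathbf{Alg}(\Sigma)$ if and only if it is given by a $\mu$-basic quantitative equational theory (i.e. it is the class of all quantitative $\Sigma$-algebras satisfying that theory).
   Context: $\mathbf{Met}$ is the category of metric spaces (distance $\infty$ allowed) and nonexpanding maps; products carry the supremum metric. A $\mu$-ary (discrete) signature $\Sigma$ is a set of operation symbols, each with an arity which is a cardinal $n<\mu$ (regarded as a discrete metric space, all distances $0$ or $\infty$). A quantitative $\Sigma$-algebra is a metric space $A$ equipped with a nonexpanding map $f_A:A^n\to A$ (with the supremum metric on $A^n$) for every $n$-ary symbol $f$ of $\Sigma$. $\mathbf{Alg}(\Sigma)$ is the category of quantitative $\Sigma$-algebras and nonexpanding homomorphisms, and $U_0:\mathbf{Alg}(\Sigma)\to\mathbf{Met}$ is the forgetful functor. A $\mu$-basic quantitative equation consists of a metric space $X$ of cardinality less than $\mu$ (the context), two $\Sigma$-terms $p,q$ with variables in the underlying set of $X$, and a real number $\varepsilon\ge 0$; it is written $p=_\varepsilon q$ in context $X$. A quantitative $\Sigma$-algebra $A$ satisfies it if for every nonexpanding map $a:X\to A$, the values $p_A(a)$, $q_A(a)$ of the terms under the interpretation $a$ of variables satisfy $d(p_A(a),q_A(a))\le\varepsilon$. A $\mu$-basic quantitative equational theory is a set of $\mu$-basic quantitative equations; an algebra satisfies it if it satisfies all of its equations. $\mathit{Surj}$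 is the class of surjective nonexpanding maps and $\mathit{Inj}$ is the class of isometries (distance-preserving maps) in $\mathbf{Met}$. A metric space $X$ is $\mu$-generated (with respect to $\mathit{Inj}$) if $\mathbf{Met}(X,-):\mathbf{Met}\to\mathbf{Set}$ preserves colimits of $\mu$-directed diagrams of isometries. A nonexpanding map $f:A\to B$ is a $\mu$-pure epimorphism if for every $\mu$-generated $X$ every morphism $X\to B$ factors through $f$. A class of quantitative $\Sigma$-algebras is identified with the corresponding full subcategory of $\mathbf{Alg}(\Sigma)$. A $\mathit{Surj}$-Birkhoff subcategory of $\mathbf{Alg}(\Sigma)$ is a full replete subcategory closed under products, $\mathit{Inj}$-subalgebras (if $g:K\to L$ is a homomorphism which is an isometry and $L$ is in the subcategory, then so is $K$) and $U_0$-split quotients (if $g:K\to L$ is a homomorphism such that $U_0(g)$ is a split epimorphism and $K$ is in the subcategory, then so is $L$). It is a $\mu$-$\mathit{Surj}$-Birkhoff subcategory if moreover it is closed under quotients $f:A\to B$ such that $U_0(f)$ is a $\mu$-pure epimorphism. *)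

theory Defs
  imports
    "HOL-Library.FuncSet"
    "HOL-Library.Extended_Nat"
    "HOL-Library.Extended_Nonnegative_Real"
begin

unbundle cardinal_syntax

section \<open>Size\<close>

text \<open>
  Sets and classes are rendered by a Grothendieck universe.  The type variable \<open>'u\<close> stands for a
  type whose cardinality is an uncountable inaccessible cardinal; a set is a collection of
  cardinality less than that of \<open>'u\<close> (up to bijection: a small subset of \<open>'u\<close>), and a class is an
  arbitrary collection of structures carried by small subsets of \<open>'u\<close>.
\<close>

definition inaccessible :: "'a rel \<Rightarrow> bool" where
  "inaccessible r \<longleftrightarrow> Card_order r \<and> natLeq <o r \<and> regularCard r \<and>
     (\<forall>A :: 'a set. |A| <o r \<longrightarrow> |Pow A| <o r)"

definition small :: "'u set \<Rightarrow> bool" where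
  "small A \<longleftrightarrow> |A| <o |UNIV :: 'u set|"


section \<open>The category of metric spaces\<close>

record 'a emet =
  pts :: "'a set"
  edist :: "'a \<Rightarrow> 'a \<Rightarrow> ennreal"

definition emetric :: "'a emet \<Rightarrow> bool" where
  "emetric X \<longleftrightarrow>
     (\<forall>x\<in>pts X. \<forall>y\<in>pts X. edist X x y = 0 \<longleftrightarrow> x = y) \<and>
     (\<forall>x\<in>pts X. \<forall>y\<in>pts X. edist X x y = edist X y x) \<and>
     (\<forall>x\<in>pts X. \<forall>y\<in>pts X. \<forall>z\<in>pts X. edist X x z \<le> edist X x y + edist X y z)"

definition Met :: "'u emet set" where
  "Met = {X. emetric X \<and> small (pts X)}"

text \<open>
  Morphisms are extensional functions, so that equality of morphisms is equality in HOL; the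
  composite of \<open>f\<close> on \<open>X\<close> with \<open>g\<close> is \<open>compose (pts X) g f\<close>.
\<close>

definition met_hom :: "'a emet \<Rightarrow> 'b emet \<Rightarrow> ('a \<Rightarrow> 'b) set" where
  "met_hom X Y = {h \<in> pts X \<rightarrow>\<^sub>E pts Y.
     \<forall>x\<in>pts X. \<forall>y\<in>pts X. edist Y (h x) (h y) \<le> edist X x y}"

definition id_hom :: "'a emet \<Rightarrow> 'a \<Rightarrow> 'a" where
  "id_hom X = (\<lambda>x\<in>pts X. x)"

definition isometry :: "'a emet \<Rightarrow> 'b emet \<Rightarrow> ('a \<Rightarrow> 'b) \<Rightarrow> bool" where
  "isometry X Y h \<longleftrightarrow> h \<in> met_hom X Y \<and>
     (\<forall>x\<in>pts X. \<forall>y\<in>pts X. edist Y (h x) (h y) = edist X x y)"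

definition split_epi :: "'a emet \<Rightarrow> 'b emet \<Rightarrow> ('a \<Rightarrow> 'b) \<Rightarrow> bool" where
  "split_epi X Y f \<longleftrightarrow> f \<in> met_hom X Y \<and>
     (\<exists>s\<in>met_hom Y X. compose (pts Y) f s = id_hom Y)"

definition met_prod :: "'i set \<Rightarrow> ('i \<Rightarrow> 'a emet) \<Rightarrow> ('i \<Rightarrow> 'a) emet" where
  "met_prod I X = \<lparr>pts = (\<Pi>\<^sub>E i\<in>I. pts (X i)),
                   edist = (\<lambda>x y. SUP i\<in>I. edist (X i) (x i) (y i))\<rparr>"


section \<open>Generated objects and pure epimorphisms\<close>

definition mu_directed :: "'m rel \<Rightarrow> 'i set \<Rightarrow> 'i rel \<Rightarrow> bool" where
  "mu_directed \<mu> I r \<longleftrightarrow> partial_order_on I r \<and>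
     (\<forall>J. J \<subseteq> I \<and> |J| <o \<mu> \<longrightarrow> (\<exists>u\<in>I. \<forall>j\<in>J. (j, u) \<in> r))"

text \<open>
  \<open>\<phi> i j\<close> is the connecting map from \<open>D i\<close> to \<open>D j\<close> for \<open>i\<close> below \<open>j\<close>.  Every small
  poset is isomorphic to one carried by a small subset of \<open>'u\<close>.
\<close>

definition directed_inj_diagram ::
  "'m rel \<Rightarrow> 'u set \<Rightarrow> 'u rel \<Rightarrow> ('u \<Rightarrow> 'u emet) \<Rightarrow> ('u \<Rightarrow> 'u \<Rightarrow> 'u \<Rightarrow> 'u) \<Rightarrow> bool" where
  "directed_inj_diagram \<mu> I r D \<phi> \<longleftrightarrow> small I \<and> mu_directed \<mu> I r \<and>
     (\<forall>i\<in>I. D i \<in> Met) \<and>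
     (\<forall>(i, j)\<in>r. isometry (D i) (D j) (\<phi> i j)) \<and>
     (\<forall>i\<in>I. \<phi> i i = id_hom (D i)) \<and>
     (\<forall>i j k. (i, j) \<in> r \<and> (j, k) \<in> r \<longrightarrow> compose (pts (D i)) (\<phi> j k) (\<phi> i j) = \<phi> i k)"

definition met_cocone ::
  "'u set \<Rightarrow> 'u rel \<Rightarrow> ('u \<Rightarrow> 'u emet) \<Rightarrow> ('u \<Rightarrow> 'u \<Rightarrow> 'u \<Rightarrow> 'u) \<Rightarrow>
   'u emet \<Rightarrow> ('u \<Rightarrow> 'u \<Rightarrow> 'u) \<Rightarrow> bool" where
  "met_cocone I r D \<phi> C c \<longleftrightarrow> C \<in> Met \<and> (\<forall>i\<in>I. c i \<in> met_hom (D i) C) \<and>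
     (\<forall>(i, j)\<in>r. compose (pts (D i)) (c j) (\<phi> i j) = c i)"

definition met_colimit ::
  "'u set \<Rightarrow> 'u rel \<Rightarrow> ('u \<Rightarrow> 'u emet) \<Rightarrow> ('u \<Rightarrow> 'u \<Rightarrow> 'u \<Rightarrow> 'u) \<Rightarrow>
   'u emet \<Rightarrow> ('u \<Rightarrow> 'u \<Rightarrow> 'u) \<Rightarrow> bool" where
  "met_colimit I r D \<phi> C c \<longleftrightarrow> met_cocone I r D \<phi> C c \<and>
     (\<forall>E e. met_cocone I r D \<phi> E e \<longrightarrow>
        (\<exists>!h. h \<in> met_hom C E \<and> (\<forall>i\<in>I. compose (pts (D i)) h (c i) = e i)))"

definition set_cocone ::
  "'u set \<Rightarrow> 'u rel \<Rightarrow> ('u \<Rightarrow> 'b set) \<Rightarrow> ('u \<Rightarrow> 'u \<Rightarrow> 'b \<Rightarrow> 'b) \<Rightarrow>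
   'c set \<Rightarrow> ('u \<Rightarrow> 'b \<Rightarrow> 'c) \<Rightarrow> bool" where
  "set_cocone I r S \<psi> Z z \<longleftrightarrow> (\<forall>i\<in>I. z i \<in> S i \<rightarrow>\<^sub>E Z) \<and>
     (\<forall>(i, j)\<in>r. compose (S i) (z j) (\<psi> i j) = z i)"

text \<open>
  The universal property quantifies over the small subsets \<open>Z\<close> of \<open>'u\<close>, to which every
  small set is isomorphic; the sets \<open>S i\<close> and \<open>C\<close> may live in another type.
\<close>

definition set_colimit ::
  "'u set \<Rightarrow> 'u rel \<Rightarrow> ('u \<Rightarrow> 'b set) \<Rightarrow> ('u \<Rightarrow> 'u \<Rightarrow> 'b \<Rightarrow> 'b) \<Rightarrow>
   'b set \<Rightarrow> ('u \<Rightarrow> 'b \<Rightarrow> 'b) \<Rightarrow> bool" where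
  "set_colimit I r S \<psi> C c \<longleftrightarrow> set_cocone I r S \<psi> C c \<and>
     (\<forall>(Z :: 'u set) z. small Z \<and> set_cocone I r S \<psi> Z z \<longrightarrow>
        (\<exists>!h. h \<in> C \<rightarrow>\<^sub>E Z \<and> (\<forall>i\<in>I. compose (S i) h (c i) = z i)))"

text \<open>The action of the functor \<open>Met(X, -)\<close> on a morphism \<open>f\<close> with domain \<open>Y\<close>.\<close>

definition hom_map :: "'u emet \<Rightarrow> 'u emet \<Rightarrow> ('u \<Rightarrow> 'u) \<Rightarrow> ('u \<Rightarrow> 'u) \<Rightarrow> 'u \<Rightarrow> 'u" where
  "hom_map X Y f = (\<lambda>g\<in>met_hom X Y. compose (pts X) f g)"

definition mu_generated :: "'m rel \<Rightarrow> 'u emet \<Rightarrow> bool" where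
  "mu_generated \<mu> X \<longleftrightarrow> X \<in> Met \<and>
     (\<forall>I r D \<phi> C c. directed_inj_diagram \<mu> I r D \<phi> \<and> met_colimit I r D \<phi> C c \<longrightarrow>
        set_colimit I r (\<lambda>i. met_hom X (D i)) (\<lambda>i j. hom_map X (D i) (\<phi> i j))
          (met_hom X C) (\<lambda>i. hom_map X (D i) (c i)))"

definition mu_pure_epi :: "'m rel \<Rightarrow> 'u emet \<Rightarrow> 'u emet \<Rightarrow> ('u \<Rightarrow> 'u) \<Rightarrow> bool" where
  "mu_pure_epi \<mu> A B f \<longleftrightarrow> f \<in> met_hom A B \<and>
     (\<forall>X :: 'u emet. mu_generated \<mu> X \<longrightarrow>
        (\<forall>h\<in>met_hom X B. \<exists>g\<in>met_hom X A. compose (pts X) f g = h))"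


section \<open>Quantitative algebras\<close>

text \<open>
  For \<open>\<mu>\<close> equal to \<open>\<omega>\<close> or \<open>\<omega>\<^sub>1\<close>, the cardinals below \<open>\<mu>\<close> are among the natural numbers and
  \<open>\<omega>\<close>, that is, the elements of \<^typ>\<open>enat\<close>.  As a set, the arity \<open>n\<close> is \<open>idx n\<close>.
\<close>

definition idx :: "enat \<Rightarrow> nat set" where
  "idx n = {i. enat i < n}"

record 's signature =
  syms :: "'s set"
  arity :: "'s \<Rightarrow> enat"

definition mu_ary :: "'m rel \<Rightarrow> 's signature \<Rightarrow> bool" where
  "mu_ary \<mu> \<Sigma> \<longleftrightarrow> (\<forall>f\<in>syms \<Sigma>. |idx (arity \<Sigma> f)| <o \<mu>)"

definition met_power :: "enat \<Rightarrow> 'a emet \<Rightarrow> (nat \<Rightarrow> 'a) emet" where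
  "met_power n X = met_prod (idx n) (\<lambda>_. X)"

record ('s, 'a) qalg =
  U0 :: "'a emet"
  opn :: "'s \<Rightarrow> (nat \<Rightarrow> 'a) \<Rightarrow> 'a"

definition Alg :: "'s signature \<Rightarrow> ('s, 'u) qalg set" where
  "Alg \<Sigma> = {A. U0 A \<in> Met \<and>
     (\<forall>f\<in>syms \<Sigma>. opn A f \<in> met_hom (met_power (arity \<Sigma> f) (U0 A)) (U0 A))}"

definition alg_hom :: "'s signature \<Rightarrow> ('s, 'a) qalg \<Rightarrow> ('s, 'b) qalg \<Rightarrow> ('a \<Rightarrow> 'b) set" where
  "alg_hom \<Sigma> A B = {h \<in> met_hom (U0 A) (U0 B).
     \<forall>f\<in>syms \<Sigma>. \<forall>a\<in>pts (met_power (arity \<Sigma> f) (U0 A)).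
       h (opn A f a) = opn B f (compose (idx (arity \<Sigma> f)) h a)}"

definition alg_iso :: "'s signature \<Rightarrow> ('s, 'a) qalg \<Rightarrow> ('s, 'b) qalg \<Rightarrow> bool" where
  "alg_iso \<Sigma> A B \<longleftrightarrow> (\<exists>h\<in>alg_hom \<Sigma> A B. \<exists>g\<in>alg_hom \<Sigma> B A.
     compose (pts (U0 A)) g h = id_hom (U0 A) \<and> compose (pts (U0 B)) h g = id_hom (U0 B))"

definition alg_prod :: "'s signature \<Rightarrow> 'i set \<Rightarrow> ('i \<Rightarrow> ('s, 'a) qalg) \<Rightarrow> ('s, 'i \<Rightarrow> 'a) qalg" where
  "alg_prod \<Sigma> I A = (let P = met_prod I (\<lambda>i. U0 (A i)) in
     \<lparr>U0 = P,
      opn = (\<lambda>f. \<lambda>a\<in>pts (met_power (arity \<Sigma> f) P).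
               \<lambda>i\<in>I. opn (A i) f (\<lambda>k\<in>idx (arity \<Sigma> f). a k i))\<rparr>)"


section \<open>Quantitative equations\<close>

text \<open>
  In \<open>App f ts\<close> only the arguments with index in the arity of \<open>f\<close> matter; the remaining ones are
  fixed to \<open>undefined\<close> by the extensionality condition in \<open>terms\<close>.
\<close>

datatype ('s, 'v) trm = Var 'v | App 's "nat \<Rightarrow> ('s, 'v) trm"

inductive_set "terms" :: "'s signature \<Rightarrow> 'v set \<Rightarrow> ('s, 'v) trm set"
  for \<Sigma> :: "'s signature" and V :: "'v set" where
  Var: "v \<in> V \<Longrightarrow> Var v \<in> terms \<Sigma> V"
| App: "\<lbrakk>f \<in> syms \<Sigma>; ts \<in> extensional (idx (arity \<Sigma> f));
         \<And>i. i \<in> idx (arity \<Sigma> f) \<Longrightarrow> ts i \<in> terms \<Sigma> V\<rbrakk> \<Longrightarrow> App f ts \<in> terms \<Sigma> V"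

primrec interp :: "'s signature \<Rightarrow> ('s, 'a) qalg \<Rightarrow> ('v \<Rightarrow> 'a) \<Rightarrow> ('s, 'v) trm \<Rightarrow> 'a" where
  "interp \<Sigma> A a (Var v) = a v"
| "interp \<Sigma> A a (App f ts) = opn A f (restrict (\<lambda>i. interp \<Sigma> A a (ts i)) (idx (arity \<Sigma> f)))"

record ('s, 'v) qeq =
  ctxt :: "'v emet"
  lhs :: "('s, 'v) trm"
  rhs :: "('s, 'v) trm"
  bnd :: real

definition mu_basic :: "'m rel \<Rightarrow> 's signature \<Rightarrow> ('s, 'v) qeq \<Rightarrow> bool" where
  "mu_basic \<mu> \<Sigma> e \<longleftrightarrow> emetric (ctxt e) \<and> |pts (ctxt e)| <o \<mu> \<and>
     lhs e \<in> terms \<Sigma> (pts (ctxt e)) \<and> rhs e \<in> terms \<Sigma> (pts (ctxt e)) \<and> 0 \<le> bnd e"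

definition satisfies :: "'s signature \<Rightarrow> ('s, 'a) qalg \<Rightarrow> ('s, 'v) qeq \<Rightarrow> bool" where
  "satisfies \<Sigma> A e \<longleftrightarrow> (\<forall>a\<in>met_hom (ctxt e) (U0 A).
     edist (U0 A) (interp \<Sigma> A a (lhs e)) (interp \<Sigma> A a (rhs e)) \<le> ennreal (bnd e))"

text \<open>
  A theory is a set, not a proper class, of equations.  Contexts have cardinality below \<open>\<mu>\<close>, so
  up to renaming of variables they are carried by subsets of \<open>'u\<close>.
\<close>

definition mu_basic_theory :: "'m rel \<Rightarrow> 's signature \<Rightarrow> ('s, 'u) qeq set \<Rightarrow> bool" where
  "mu_basic_theory \<mu> \<Sigma> T \<longleftrightarrow> |T| <o |UNIV :: 'u set| \<and> (\<forall>e\<in>T. mu_basic \<mu> \<Sigma> e)"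

definition models :: "'s signature \<Rightarrow> ('s, 'u) qeq set \<Rightarrow> ('s, 'u) qalg set" where
  "models \<Sigma> T = {A \<in> Alg \<Sigma>. \<forall>e\<in>T. satisfies \<Sigma> A e}"


section \<open>Birkhoff subcategories\<close>

text \<open>A full subcategory is given by its class of objects.\<close>

definition replete :: "'s signature \<Rightarrow> ('s, 'u) qalg set \<Rightarrow> bool" where
  "replete \<Sigma> \<K> \<longleftrightarrow> (\<forall>A\<in>\<K>. \<forall>B\<in>Alg \<Sigma>. alg_iso \<Sigma> A B \<longrightarrow> B \<in> \<K>)"

text \<open>
  The product algebra lives in the type \<open>'u \<Rightarrow> 'u\<close>; closure is stated for its isomorphic copies in
  \<open>'u\<close>.
\<close>

definition closed_under_products :: "'s signature \<Rightarrow> ('s, 'u) qalg set \<Rightarrow> bool" where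
  "closed_under_products \<Sigma> \<K> \<longleftrightarrow>
     (\<forall>(I :: 'u set) A. small I \<and> (\<forall>i\<in>I. A i \<in> \<K>) \<longrightarrow>
        (\<forall>P\<in>Alg \<Sigma>. alg_iso \<Sigma> (alg_prod \<Sigma> I A) P \<longrightarrow> P \<in> \<K>))"

definition closed_under_inj_subalgebras :: "'s signature \<Rightarrow> ('s, 'u) qalg set \<Rightarrow> bool" where
  "closed_under_inj_subalgebras \<Sigma> \<K> \<longleftrightarrow>
     (\<forall>A\<in>Alg \<Sigma>. \<forall>B\<in>\<K>. \<forall>g\<in>alg_hom \<Sigma> A B. isometry (U0 A) (U0 B) g \<longrightarrow> A \<in> \<K>)"

definition closed_under_split_quotients :: "'s signature \<Rightarrow> ('s, 'u) qalg set \<Rightarrow> bool" where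
  "closed_under_split_quotients \<Sigma> \<K> \<longleftrightarrow>
     (\<forall>A\<in>\<K>. \<forall>B\<in>Alg \<Sigma>. \<forall>g\<in>alg_hom \<Sigma> A B. split_epi (U0 A) (U0 B) g \<longrightarrow> B \<in> \<K>)"

definition closed_under_pure_quotients :: "'m rel \<Rightarrow> 's signature \<Rightarrow> ('s, 'u) qalg set \<Rightarrow> bool" where
  "closed_under_pure_quotients \<mu> \<Sigma> \<K> \<longleftrightarrow>
     (\<forall>A\<in>\<K>. \<forall>B\<in>Alg \<Sigma>. \<forall>f\<in>alg_hom \<Sigma> A B.
        f ` pts (U0 A) = pts (U0 B) \<and> mu_pure_epi \<mu> (U0 A) (U0 B) f \<longrightarrow> B \<in> \<K>)"

definition surj_birkhoff :: "'s signature \<Rightarrow> ('s, 'u) qalg set \<Rightarrow> bool" where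
  "surj_birkhoff \<Sigma> \<K> \<longleftrightarrow> \<K> \<subseteq> Alg \<Sigma> \<and> replete \<Sigma> \<K> \<and> closed_under_products \<Sigma> \<K> \<and>
     closed_under_inj_subalgebras \<Sigma> \<K> \<and> closed_under_split_quotients \<Sigma> \<K>"

definition mu_surj_birkhoff :: "'m rel \<Rightarrow> 's signature \<Rightarrow> ('s, 'u) qalg set \<Rightarrow> bool" where
  "mu_surj_birkhoff \<mu> \<Sigma> \<K> \<longleftrightarrow> surj_birkhoff \<Sigma> \<K> \<and> closed_under_pure_quotients \<mu> \<Sigma> \<K>"

end

(*
  A space is mu-generated with respect to isometries iff it has less than mu points: colimits of
  mu-directed diagrams of isometries are unions, and every space is the mu-directed union of its
  subspaces with less than mu points.  Hence contexts lift along mu-pure epimorphisms, which gives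
  the closure of an equational class under quotients by them.

  Conversely, let B satisfy all equations that hold in K.  Let Y be the coproduct of all contexts X
  over all nonexpanding maps X -> B, and let F be the subalgebra generated by the image of Y in a
  product of members of K which realises all distances between terms over Y that occur in K.  Two
  terms over Y involve less than mu components of Y, and together these components form a context.
  Since B satisfies the equations of K in this context, Y -> B extends to a homomorphism F -> B.  It
  is a mu-pure epimorphism by the choice of Y.
*)
theory Submission
  imports Defs
begin

section \<open>Cardinal arithmetic\<close>

text \<open>Two terms use fewer than \<mu> variables, because arities are below \<mu> and \<mu> is
  regular, but the space \<open>Y\<close> is in general too large to be a context. Taking the space
  of \<open>B\<close> in place of \<open>Y\<close> would fail: an assignment that is nonexpanding on
  the subspace of the occurring points need not extend to the remaining points. In a coproduct,
  distinct components are at distance \<infinity> and can be treated independently. The price is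
  that the map back to \<open>B\<close> need not have a section; it only has liftings of small
  contexts, which is what \<mu>-purity expresses. The theory must be a set although contexts form a
  proper class. Since \<mu> is at most the first uncountable cardinal, contexts are countable;
  renaming their points into a fixed countable set and normalising the distance off the carrier
  leaves only a set of equations. Bounds of equations are real while distances may be \<infinity>;
  rationals strictly between two distances bridge this gap.\<close>

lemma card_less_subset: "A \<subseteq> B \<Longrightarrow> |B| <o r \<Longrightarrow> |A| <o r"
  by (rule ordLeq_ordLess_trans[OF card_of_mono1])

lemma card_less_image: "|A| <o r \<Longrightarrow> |f ` A| <o r"
  by (rule ordLeq_ordLess_trans[OF card_of_image])

lemma card_less_inj:
  assumes "inj_on f A" "f ` A \<subseteq> B" "|B| <o r"
  shows "|A| <o r"
proof -
  have "|A| \<le>o |B|"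
    using assms(1,2) card_of_ordLeq[of A B] by auto
  then show ?thesis
    using assms(3) by (rule ordLeq_ordLess_trans)
qed

lemma card_less_finite:
  assumes "Cinfinite r" "finite A"
  shows "|A| <o r"
proof -
  have "|A| <o natLeq"
    using assms(2) by (simp add: finite_iff_ordLess_natLeq)
  then show ?thesis
    using natLeq_ordLeq_cinfinite[OF assms(1)] by (rule ordLess_ordLeq_trans)
qed

lemma card_less_UN:
  assumes "Cinfinite r" "regularCard r" "|I| <o r" "\<And>i. i \<in> I \<Longrightarrow> |A i| <o r"
  shows "|\<Union>i\<in>I. A i| <o r"
  using assms cinfinite_def regularCard_stable stable_UNION by blast

lemma card_less_Sigma:
  assumes "Cinfinite r" "regularCard r" "|I| <o r" "\<And>i. i \<in> I \<Longrightarrow> |A i| <o r"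
  shows "|Sigma I A| <o r"
proof -
  have "Sigma I A = (\<Union>i\<in>I. Pair i ` A i)"
    by blast
  then show ?thesis
    using assms by (auto intro!: card_less_UN card_less_image)
qed

lemma card_less_Un:
  assumes "Cinfinite r" "regularCard r" "|A| <o r" "|B| <o r"
  shows "|A \<union> B| <o r"
proof -
  have "|\<Union>b\<in>{True, False}. if b then A else B| <o r"
    using assms by (intro card_less_UN) (auto intro: card_less_finite)
  then show ?thesis by (simp add: Un_commute)
qed

lemma card_less_Plus:
  assumes "Cinfinite r" "regularCard r" "|A| <o r" "|B| <o r"
  shows "|A <+> B| <o r"
  using assms by (auto simp: Plus_def intro!: card_less_Un card_less_image)

lemma inaccessible_Cinfinite: "inaccessible r \<Longrightarrow> Cinfinite r"
  unfolding inaccessible_def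
  using cinfinite_mono[OF ordLess_imp_ordLeq natLeq_cinfinite] by blast

lemma inaccessible_regularCard: "inaccessible r \<Longrightarrow> regularCard r"
  by (simp add: inaccessible_def)

lemma card_less_inj_into_UNIV:
  assumes "|A| <o |UNIV :: 'u set|"
  obtains f :: "'a \<Rightarrow> 'u" where "inj_on f A"
  using assms card_of_ordLeq[of A "UNIV :: 'u set"] ordLess_imp_ordLeq by blast

text \<open>Inaccessibility speaks only of subsets of the universe type, so a set of another type is
  first copied into it.\<close>

lemma card_less_Pow:
  assumes "inaccessible |UNIV :: 'u set|" "|A| <o |UNIV :: 'u set|"
  shows "|Pow A| <o |UNIV :: 'u set|"
proof -
  obtain f :: "'a \<Rightarrow> 'u" where f: "inj_on f A"
    using assms(2) by (rule card_less_inj_into_UNIV)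
  have "|f ` A| <o |UNIV :: 'u set|"
    using assms(2) by (rule card_less_image)
  then have "|Pow (f ` A)| <o |UNIV :: 'u set|"
    using assms(1) by (simp add: inaccessible_def)
  moreover have "inj_on ((`) f) (Pow A)" "(`) f ` Pow A \<subseteq> Pow (f ` A)"
    using f by (auto simp: inj_on_image_Pow)
  ultimately show ?thesis
    by (blast intro: card_less_inj)
qed

lemma card_less_countable:
  assumes "inaccessible |UNIV :: 'u set|" "countable A"
  shows "|A| <o |UNIV :: 'u set|"
proof -
  obtain f :: "'a \<Rightarrow> nat" where "inj_on f A"
    using assms(2) by (auto simp: countable_def)
  then have "|A| \<le>o |UNIV :: nat set|"
    using card_of_ordLeq[of A "UNIV :: nat set"] by auto
  then show ?thesis
    using assms(1) card_of_nat ordLeq_ordIso_trans ordLeq_ordLess_trans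
    unfolding inaccessible_def by blast
qed

text \<open>An extensional function is recovered from its graph, which is a subset of
  \<open>Sigma I A\<close>.\<close>

lemma card_less_PiE:
  assumes "inaccessible |UNIV :: 'u set|" "|I| <o |UNIV :: 'u set|"
    and "\<And>i. i \<in> I \<Longrightarrow> |A i| <o |UNIV :: 'u set|"
  shows "|Pi\<^sub>E I A| <o |UNIV :: 'u set|"
proof (rule card_less_inj)
  show "|Pow (Sigma I A)| <o |UNIV :: 'u set|"
    using assms inaccessible_Cinfinite inaccessible_regularCard
    by (intro card_less_Pow card_less_Sigma) auto
  show "inj_on (\<lambda>f. (\<lambda>i. (i, f i)) ` I) (Pi\<^sub>E I A)"
  proof (rule inj_onI)
    fix f g assume fg: "f \<in> Pi\<^sub>E I A" "g \<in> Pi\<^sub>E I A"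
      and eq: "(\<lambda>i. (i, f i)) ` I = (\<lambda>i. (i, g i)) ` I"
    have "f i = g i" if "i \<in> I" for i
    proof -
      have "(i, f i) \<in> (\<lambda>i. (i, g i)) ` I"
        using that eq by blast
      then show ?thesis by auto
    qed
    then show "f = g" using fg by (auto intro: PiE_ext)
  qed
  show "(\<lambda>f. (\<lambda>i. (i, f i)) ` I) ` (Pi\<^sub>E I A) \<subseteq> Pow (Sigma I A)"
    by auto
qed

text \<open>Dedekind cuts embed the extended half-line into the power set of the countable set of
  rationals. Negative rationals do no harm, as \<open>ennreal\<close> sends them to 0.\<close>

lemma card_less_ennreal:
  assumes "inaccessible |UNIV :: 'u set|"
  shows "|A :: ennreal set| <o |UNIV :: 'u set|"
proof (rule card_less_inj)
  show "|Pow (UNIV :: rat set)| <o |UNIV :: 'u set|"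
    using assms by (intro card_less_Pow card_less_countable) auto
  show "inj_on (\<lambda>x. {r :: rat. ennreal (real_of_rat r) < x}) A"
  proof (rule inj_onI, rule ccontr)
    fix x y :: ennreal
    assume eq: "{r :: rat. ennreal (real_of_rat r) < x} = {r. ennreal (real_of_rat r) < y}"
      and "x \<noteq> y"
    then consider "x < y" | "y < x" by fastforce
    then show False
    proof cases
      case 1 with ennreal_rat_dense[OF this] eq show False by force
    next
      case 2 with ennreal_rat_dense[OF this] eq show False by force
    qed
  qed
qed auto

lemma card_less_real:
  assumes "inaccessible |UNIV :: 'u set|"
  shows "|A :: real set| <o |UNIV :: 'u set|"
proof (rule card_less_inj)
  show "|Pow (UNIV :: rat set)| <o |UNIV :: 'u set|"
    using assms by (intro card_less_Pow card_less_countable) auto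
  show "inj_on (\<lambda>x. {r :: rat. real_of_rat r < x}) A"
  proof (rule inj_onI, rule ccontr)
    fix x y :: real
    assume eq: "{r :: rat. real_of_rat r < x} = {r. real_of_rat r < y}"
      and "x \<noteq> y"
    then consider "x < y" | "y < x" by fastforce
    then show False
    proof cases
      case 1 with of_rat_dense[OF this] eq show False by force
    next
      case 2 with of_rat_dense[OF this] eq show False by force
    qed
  qed
qed auto

text \<open>Regularity holds for \<omega> and for every successor of an infinite cardinal; to be
  below the successor of \<omega> means to be at most \<omega>.\<close>

lemma omega_or_omega1:
  assumes "\<mu> =o natLeq \<or> \<mu> =o cardSuc natLeq"
  shows omega_or_omega1_Cinfinite: "Cinfinite \<mu>"
    and omega_or_omega1_regularCard: "regularCard \<mu>"
    and omega_or_omega1_countable: "|A| <o \<mu> \<Longrightarrow> countable A"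
proof -
  have nat: "Cinfinite natLeq"
    by (simp add: natLeq_cinfinite natLeq_Card_order)
  then have suc: "Cinfinite (cardSuc natLeq)"
    by (rule Cinfinite_cardSuc)
  show "Cinfinite \<mu>"
    using assms Cinfinite_cong[OF ordIso_symmetric nat] Cinfinite_cong[OF ordIso_symmetric suc]
    by blast
  show "regularCard \<mu>"
    using assms regularCard_ordIso[OF ordIso_symmetric nat regularCard_natLeq]
      regularCard_ordIso[OF ordIso_symmetric suc regularCard_cardSuc[OF nat]] by blast
  assume A: "|A| <o \<mu>"
  have "|A| \<le>o natLeq"
    using assms
  proof
    assume "\<mu> =o natLeq"
    then show ?thesis
      using A ordLess_ordIso_trans ordLess_imp_ordLeq by blast
  next
    assume "\<mu> =o cardSuc natLeq"
    then have "|A| <o cardSuc natLeq"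
      using A ordLess_ordIso_trans by blast
    then show ?thesis
      using cardSuc_ordLeq_ordLess[OF natLeq_Card_order card_of_Card_order[of A]]
      by simp
  qed
  then have "|A| \<le>o |UNIV :: nat set|"
    using card_of_nat ordIso_symmetric ordLeq_ordIso_trans by blast
  then show "countable A"
    using card_of_ordLeq[of A "UNIV :: nat set"] by (auto simp: countable_def)
qed

section \<open>Metric spaces\<close>

lemma emetricD:
  assumes "emetric X"
  shows emetric_eq_0_iff: "\<lbrakk>x \<in> pts X; y \<in> pts X\<rbrakk> \<Longrightarrow> edist X x y = 0 \<longleftrightarrow> x = y"
    and emetric_commute: "\<lbrakk>x \<in> pts X; y \<in> pts X\<rbrakk> \<Longrightarrow> edist X x y = edist X y x"
    and emetric_triangle: "\<lbrakk>x \<in> pts X; y \<in> pts X; z \<in> pts X\<rbrakk> \<Longrightarrow>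
      edist X x z \<le> edist X x y + edist X y z"
  using assms unfolding emetric_def by blast+

lemma emetric_subset: "emetric \<lparr>pts = S, edist = edist X\<rparr>" if "emetric X" "S \<subseteq> pts X"
  using that unfolding emetric_def by (simp add: subset_iff)

lemma Met_subset: "\<lparr>pts = S, edist = edist X\<rparr> \<in> Met" if "X \<in> Met" "S \<subseteq> pts X"
  using that card_less_subset[of S "pts X"] by (auto simp: Met_def small_def emetric_subset)

lemma met_homI:
  assumes "\<And>x. x \<in> pts X \<Longrightarrow> h x \<in> pts Y" "h \<in> extensional (pts X)"
    and "\<And>x y. \<lbrakk>x \<in> pts X; y \<in> pts X\<rbrakk> \<Longrightarrow> edist Y (h x) (h y) \<le> edist X x y"
  shows "h \<in> met_hom X Y"
  using assms by (auto simp: met_hom_def PiE_iff)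

lemma met_homD:
  assumes "h \<in> met_hom X Y"
  shows met_hom_PiE: "h \<in> pts X \<rightarrow>\<^sub>E pts Y"
    and met_hom_pts: "x \<in> pts X \<Longrightarrow> h x \<in> pts Y"
    and met_hom_extensional: "h \<in> extensional (pts X)"
    and met_hom_nonexpanding: "\<lbrakk>x \<in> pts X; y \<in> pts X\<rbrakk> \<Longrightarrow> edist Y (h x) (h y) \<le> edist X x y"
  using assms by (auto simp: met_hom_def PiE_iff)

lemma met_hom_eqI:
  assumes "g \<in> met_hom X Y" "h \<in> met_hom X Z" "\<And>x. x \<in> pts X \<Longrightarrow> g x = h x"
  shows "g = h"
  using assms by (metis extensionalityI met_hom_extensional)

lemma met_hom_compose:
  assumes "g \<in> met_hom X Y" "h \<in> met_hom Y Z"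
  shows "compose (pts X) h g \<in> met_hom X Z"
proof (rule met_homI)
  fix x y assume "x \<in> pts X" "y \<in> pts X"
  then show "edist Z (compose (pts X) h g x) (compose (pts X) h g y) \<le> edist X x y"
    using met_hom_nonexpanding[OF assms(2), of "g x" "g y"] met_hom_nonexpanding[OF assms(1), of x y]
      met_hom_pts[OF assms(1)] by (auto simp: compose_eq intro: order_trans)
qed (auto simp: compose_eq met_hom_pts[OF assms(1)] met_hom_pts[OF assms(2)])

lemma id_hom_met_hom: "id_hom X \<in> met_hom X X"
  by (rule met_homI) (auto simp: id_hom_def)

lemma isometryD:
  assumes "isometry X Y h"
  shows isometry_met_hom: "h \<in> met_hom X Y"
    and isometry_edist: "\<lbrakk>x \<in> pts X; y \<in> pts X\<rbrakk> \<Longrightarrow> edist Y (h x) (h y) = edist X x y"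
  using assms by (auto simp: isometry_def)

lemma isometry_inj:
  assumes "isometry X Y h" "emetric X" "emetric Y"
  shows "inj_on h (pts X)"
  using assms
  by (intro inj_onI) (metis emetric_eq_0_iff isometry_edist isometry_met_hom met_hom_pts)

text \<open>In \<^typ>\<open>ennreal\<close>, \<open>\<infinity> - \<infinity> = \<infinity>\<close>, whence the case distinction.\<close>

definition ediff :: "ennreal \<Rightarrow> ennreal \<Rightarrow> ennreal" where
  "ediff a b = (if a = b then 0 else max (a - b) (b - a))"

text \<open>Expresses the distance by addition alone, so that the triangle inequality can be proved
  without truncated subtraction and its value at infinity.\<close>

lemma ediff_le_iff: "ediff a b \<le> e \<longleftrightarrow> a \<le> b + e \<and> b \<le> a + e"
  by (auto simp: ediff_def ennreal_minus_le_iff)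

lemma emetric_ediff: "emetric \<lparr>pts = S, edist = ediff\<rparr>"
proof -
  have "ediff a b = 0 \<longleftrightarrow> a = b" for a b
    using ediff_le_iff[of a b 0] by auto
  moreover have "ediff a b = ediff b a" for a b
    by (auto simp: ediff_def max.commute)
  moreover have "ediff a c \<le> ediff a b + ediff b c" for a b c
  proof -
    have 1: "a \<le> b + ediff a b" "b \<le> a + ediff a b" "b \<le> c + ediff b c" "c \<le> b + ediff b c"
      using ediff_le_iff order_refl by blast+
    have "a \<le> (c + ediff b c) + ediff a b" "c \<le> (a + ediff a b) + ediff b c"
      using 1 add_right_mono order_trans by blast+
    then show ?thesis
      by (simp add: ediff_le_iff ac_simps)
  qed
  ultimately show ?thesis
    unfolding emetric_def by simp metis
qed

text \<open>The distance off the carrier is set to 0 so that a renamed context is determined by its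
  points and their distances.\<close>

definition met_transport :: "('a \<Rightarrow> 'b) \<Rightarrow> 'a emet \<Rightarrow> 'b emet" where
  "met_transport g X = \<lparr>pts = g ` pts X,
     edist = (\<lambda>u v. if u \<in> g ` pts X \<and> v \<in> g ` pts X
                    then edist X (inv_into (pts X) g u) (inv_into (pts X) g v) else 0)\<rparr>"

lemma pts_met_transport [simp]: "pts (met_transport g X) = g ` pts X"
  by (simp add: met_transport_def)

lemma edist_met_transport [simp]:
  "\<lbrakk>inj_on g (pts X); x \<in> pts X; y \<in> pts X\<rbrakk> \<Longrightarrow> edist (met_transport g X) (g x) (g y) = edist X x y"
  by (simp add: met_transport_def)

lemma emetric_transport: "\<lbrakk>emetric X; inj_on g (pts X)\<rbrakk> \<Longrightarrow> emetric (met_transport g X)"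
  using emetricD[of X] unfolding emetric_def by (auto simp: inj_on_eq_iff)

lemma met_transport_hom: "inj_on g (pts X) \<Longrightarrow> restrict g (pts X) \<in> met_hom X (met_transport g X)"
  by (rule met_homI) auto

lemma met_transport_inv_hom:
  assumes "inj_on g (pts X)"
  shows "restrict (inv_into (pts X) g) (g ` pts X) \<in> met_hom (met_transport g X) X"
  using assms by (intro met_homI) auto


section \<open>Directed diagrams of isometries\<close>

locale inj_diagram =
  fixes \<mu> :: "'m rel" and I :: "'u set" and r D \<phi>
  assumes diagram: "directed_inj_diagram \<mu> I r D \<phi>"
    and mu: "Cinfinite \<mu>"
begin

lemma
  shows small_I: "small I"
    and refl: "i \<in> I \<Longrightarrow> (i, i) \<in> r"
    and trans: "\<lbrakk>(i, j) \<in> r; (j, k) \<in> r\<rbrakk> \<Longrightarrow> (i, k) \<in> r"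
    and in_I: "(i, j) \<in> r \<Longrightarrow> i \<in> I" "(i, j) \<in> r \<Longrightarrow> j \<in> I"
    and upper_bound: "\<lbrakk>J \<subseteq> I; |J| <o \<mu>\<rbrakk> \<Longrightarrow> \<exists>u\<in>I. \<forall>j\<in>J. (j, u) \<in> r"
    and D_Met: "i \<in> I \<Longrightarrow> D i \<in> Met"
    and \<phi>_isometry: "(i, j) \<in> r \<Longrightarrow> isometry (D i) (D j) (\<phi> i j)"
    and \<phi>_comp: "\<lbrakk>(i, j) \<in> r; (j, k) \<in> r\<rbrakk> \<Longrightarrow> compose (pts (D i)) (\<phi> j k) (\<phi> i j) = \<phi> i k"
  using diagram
  by (auto simp: directed_inj_diagram_def mu_directed_def partial_order_on_def preorder_on_def
      refl_on_def elim: transE)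

lemma D_emetric: "i \<in> I \<Longrightarrow> emetric (D i)"
  using D_Met by (simp add: Met_def)

lemma upper_bound2: "\<lbrakk>i \<in> I; j \<in> I\<rbrakk> \<Longrightarrow> \<exists>k\<in>I. (i, k) \<in> r \<and> (j, k) \<in> r"
  using upper_bound[of "{i, j}"] card_less_finite[OF mu, of "{i, j}"] by auto

lemma \<phi>_pts: "\<lbrakk>(i, j) \<in> r; x \<in> pts (D i)\<rbrakk> \<Longrightarrow> \<phi> i j x \<in> pts (D j)"
  by (rule met_hom_pts[OF isometry_met_hom[OF \<phi>_isometry]])

lemma \<phi>_edist:
  "\<lbrakk>(i, j) \<in> r; x \<in> pts (D i); y \<in> pts (D i)\<rbrakk> \<Longrightarrow> edist (D j) (\<phi> i j x) (\<phi> i j y) = edist (D i) x y"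
  by (rule isometry_edist[OF \<phi>_isometry])

lemma \<phi>_\<phi>: "\<lbrakk>(i, j) \<in> r; (j, k) \<in> r; x \<in> pts (D i)\<rbrakk> \<Longrightarrow> \<phi> j k (\<phi> i j x) = \<phi> i k x"
  by (metis \<phi>_comp compose_eq)

text \<open>The distance in the union of the diagram between \<open>x\<^sub>0\<close> in \<open>D i\<^sub>0\<close> and \<open>z\<close> in \<open>D j\<close>.\<close>

definition dist_from :: "'u \<Rightarrow> 'u \<Rightarrow> 'u \<Rightarrow> 'u \<Rightarrow> ennreal" where
  "dist_from i\<^sub>0 x\<^sub>0 j z =
     (let k = SOME k. (j, k) \<in> r \<and> (i\<^sub>0, k) \<in> r in edist (D k) (\<phi> j k z) (\<phi> i\<^sub>0 k x\<^sub>0))"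

text \<open>The chosen upper bound and the given \<open>k\<close> lie below a common stage, and the
  connecting isometries do not change distances on the way there.\<close>

lemma dist_from:
  assumes "x\<^sub>0 \<in> pts (D i\<^sub>0)" "z \<in> pts (D j)" "(j, k) \<in> r" "(i\<^sub>0, k) \<in> r"
  shows "dist_from i\<^sub>0 x\<^sub>0 j z = edist (D k) (\<phi> j k z) (\<phi> i\<^sub>0 k x\<^sub>0)"
proof -
  define k' where "k' = (SOME k. (j, k) \<in> r \<and> (i\<^sub>0, k) \<in> r)"
  have k': "(j, k') \<in> r" "(i\<^sub>0, k') \<in> r"
    using someI[of "\<lambda>k. (j, k) \<in> r \<and> (i\<^sub>0, k) \<in> r" k] assms(3,4) by (auto simp: k'_def)
  obtain l where l: "(k, l) \<in> r" "(k', l) \<in> r"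
    using upper_bound2[of k k'] in_I assms k' by blast
  have "edist (D k') (\<phi> j k' z) (\<phi> i\<^sub>0 k' x\<^sub>0) = edist (D l) (\<phi> j l z) (\<phi> i\<^sub>0 l x\<^sub>0)"
    using \<phi>_edist[OF l(2), of "\<phi> j k' z" "\<phi> i\<^sub>0 k' x\<^sub>0"] assms k' l by (simp add: \<phi>_\<phi> \<phi>_pts)
  also have "\<dots> = edist (D k) (\<phi> j k z) (\<phi> i\<^sub>0 k x\<^sub>0)"
    using \<phi>_edist[OF l(1), of "\<phi> j k z" "\<phi> i\<^sub>0 k x\<^sub>0"] assms l by (simp add: \<phi>_\<phi> \<phi>_pts)
  finally show ?thesis
    by (simp add: dist_from_def k'_def)
qed

text \<open>All three points have images in one stage \<open>k\<close>; there the claim is the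
  triangle inequality, used in both directions.\<close>

lemma dist_from_nonexpanding:
  assumes "i\<^sub>0 \<in> I" "x\<^sub>0 \<in> pts (D i\<^sub>0)" "j \<in> I" "z \<in> pts (D j)" "z' \<in> pts (D j)"
  shows "ediff (dist_from i\<^sub>0 x\<^sub>0 j z) (dist_from i\<^sub>0 x\<^sub>0 j z') \<le> edist (D j) z z'"
proof -
  obtain k where k: "(j, k) \<in> r" "(i\<^sub>0, k) \<in> r"
    using upper_bound2 assms by blast
  have em: "emetric (D k)"
    using D_emetric in_I k by blast
  have pts: "\<phi> j k z \<in> pts (D k)" "\<phi> j k z' \<in> pts (D k)" "\<phi> i\<^sub>0 k x\<^sub>0 \<in> pts (D k)"
    using \<phi>_pts assms k by auto
  have zz': "edist (D j) z z' = edist (D k) (\<phi> j k z) (\<phi> j k z')"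
    using \<phi>_edist assms k by simp
  show ?thesis
    unfolding ediff_le_iff dist_from[OF assms(2,4) k] dist_from[OF assms(2,5) k] zz'
    using emetric_triangle[OF em pts(1,2,3)] emetric_triangle[OF em pts(2,1,3)]
      emetric_commute[OF em pts(1,2)] by (simp add: add.commute)
qed

text \<open>
  The distance to a point \<open>x\<^sub>0\<close> of the diagram is a cocone with vertex \<open>[0, \<infinity>]\<close>, which gives
  the lower bound for the distances in the colimit.
\<close>

lemma colimit_isometry:
  assumes inacc: "inaccessible |UNIV :: 'u set|"
    and colim: "met_colimit I r D \<phi> C c" and "i \<in> I"
  shows "isometry (D i) C (c i)"
  unfolding isometry_def
proof (intro conjI ballI)
  show ci: "c i \<in> met_hom (D i) C"
    using colim \<open>i \<in> I\<close> by (simp add: met_colimit_def met_cocone_def)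
  fix x x\<^sub>0 assume x: "x \<in> pts (D i)" and x\<^sub>0: "x\<^sub>0 \<in> pts (D i)"
  \<comment> \<open>Cocones live over the universe type, so their vertex has to be a copy of the
    extended half-line inside it.\<close>
  obtain g :: "ennreal \<Rightarrow> 'u" where g: "inj g"
    using card_less_ennreal[OF inacc] by (rule card_less_inj_into_UNIV)
  define E where "E = met_transport g \<lparr>pts = UNIV, edist = ediff\<rparr>"
  define e where "e j = (\<lambda>z\<in>pts (D j). g (dist_from i x\<^sub>0 j z))" for j
  have pE: "pts E = range g"
    by (simp add: E_def)
  have dE: "edist E (g a) (g b) = ediff a b" for a b
    using edist_met_transport[of g "\<lparr>pts = UNIV, edist = ediff\<rparr>" a b] g by (simp add: E_def)
  have "emetric E"
    unfolding E_def using g by (intro emetric_transport emetric_ediff) simp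
  moreover have "small (pts E)"
    using card_less_image[OF card_less_ennreal[OF inacc]] by (simp add: small_def pE)
  ultimately have E: "E \<in> Met"
    by (simp add: Met_def)
  have "e j \<in> met_hom (D j) E" if "j \<in> I" for j
    using that dist_from_nonexpanding[OF \<open>i \<in> I\<close> x\<^sub>0]
    by (intro met_homI) (auto simp: e_def pE dE)
  moreover have "compose (pts (D j)) (e k) (\<phi> j k) = e j" if jk: "(j, k) \<in> r" for j k
  proof (rule extensionalityI)
    fix z assume z: "z \<in> pts (D j)"
    obtain l where l: "(k, l) \<in> r" "(i, l) \<in> r"
      using upper_bound2 \<open>i \<in> I\<close> jk in_I by blast
    have "dist_from i x\<^sub>0 k (\<phi> j k z) = dist_from i x\<^sub>0 j z"
      using dist_from[OF x\<^sub>0 \<phi>_pts[OF jk z] l] dist_from[OF x\<^sub>0 z trans[OF jk l(1)] l(2)]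
        \<phi>_\<phi>[OF jk l(1) z] by simp
    then show "compose (pts (D j)) (e k) (\<phi> j k) z = e j z"
      using z jk by (simp add: compose_eq e_def \<phi>_pts)
  qed (auto simp: e_def)
  ultimately have "met_cocone I r D \<phi> E e"
    using E by (auto simp: met_cocone_def)
  then obtain h where h: "h \<in> met_hom C E" "compose (pts (D i)) h (c i) = e i"
    using colim \<open>i \<in> I\<close> unfolding met_colimit_def by blast
  have h_c: "h (c i y) = g (dist_from i x\<^sub>0 i y)" if "y \<in> pts (D i)" for y
    using that h(2) by (metis compose_eq e_def restrict_apply')
  have "dist_from i x\<^sub>0 i y = edist (D i) y x\<^sub>0" if y: "y \<in> pts (D i)" for y
    using dist_from[OF x\<^sub>0 y refl[OF \<open>i \<in> I\<close>] refl[OF \<open>i \<in> I\<close>]]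
      \<phi>_edist[OF refl[OF \<open>i \<in> I\<close>] y x\<^sub>0] by simp
  moreover have "edist (D i) x\<^sub>0 x\<^sub>0 = 0"
    using emetric_eq_0_iff[OF D_emetric[OF \<open>i \<in> I\<close>]] x\<^sub>0 by simp
  \<comment> \<open>The mediating map sends the two points to the numbers
    \<open>edist (D i) x x\<^sub>0\<close> and 0; as it is nonexpanding, their distance in
    \<open>C\<close> cannot be smaller.\<close>
  ultimately have "edist E (h (c i x)) (h (c i x\<^sub>0)) = edist (D i) x x\<^sub>0"
    using x x\<^sub>0 by (simp add: h_c dE ediff_def)
  then have "edist (D i) x x\<^sub>0 \<le> edist C (c i x) (c i x\<^sub>0)"
    using met_hom_nonexpanding[OF h(1)] met_hom_pts[OF ci] x x\<^sub>0 by metis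
  then show "edist C (c i x) (c i x\<^sub>0) = edist (D i) x x\<^sub>0"
    using met_hom_nonexpanding[OF ci x x\<^sub>0] by simp
qed

text \<open>The union of the images of the legs is itself the vertex of a cocone. The mediating map
  into it, viewed as an endomorphism of \<open>C\<close>, commutes with the legs and is therefore
  the identity by uniqueness.\<close>

lemma colimit_surj:
  assumes colim: "met_colimit I r D \<phi> C c"
  shows "pts C = (\<Union>i\<in>I. c i ` pts (D i))"
proof
  have C: "met_cocone I r D \<phi> C c"
    using colim by (simp add: met_colimit_def)
  then have c: "c i \<in> met_hom (D i) C" if "i \<in> I" for i
    using that by (simp add: met_cocone_def)
  show sub: "(\<Union>i\<in>I. c i ` pts (D i)) \<subseteq> pts C"
    using c by (auto dest: met_hom_pts)
  define C' where "C' = \<lparr>pts = (\<Union>i\<in>I. c i ` pts (D i)), edist = edist C\<rparr>"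
  have "C' \<in> Met"
    unfolding C'_def using sub C by (intro Met_subset) (simp_all add: met_cocone_def)
  moreover have "c i \<in> met_hom (D i) C'" if "i \<in> I" for i
    using c[OF that] that by (auto simp: met_hom_def C'_def)
  ultimately have "met_cocone I r D \<phi> C' c"
    using C by (auto simp: met_cocone_def)
  then obtain h where h: "h \<in> met_hom C C'" "\<And>i. i \<in> I \<Longrightarrow> compose (pts (D i)) h (c i) = c i"
    using colim unfolding met_colimit_def by blast
  have "h \<in> met_hom C C"
    using h(1) sub met_hom_pts[OF h(1)] unfolding C'_def
    by (intro met_homI) (auto simp: met_hom_def PiE_iff)
  moreover have "compose (pts (D i)) (id_hom C) (c i) = c i" if "i \<in> I" for i
    using c[OF that] met_hom_compose[OF c[OF that] id_hom_met_hom]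
    by (intro met_hom_eqI) (auto simp: compose_eq id_hom_def met_hom_pts)
  ultimately have "h = id_hom C"
    using colim C h(2) id_hom_met_hom unfolding met_colimit_def by blast
  then show "pts C \<subseteq> (\<Union>i\<in>I. c i ` pts (D i))"
    using met_hom_pts[OF h(1)] by (auto simp: id_hom_def C'_def)
qed

text \<open>Each point of \<open>X\<close> lands in the image of some stage, and these fewer than
  \<mu> stages have an upper bound \<open>u\<close>. Since the leg at \<open>u\<close> is an
  isometry, preimages chosen pointwise in \<open>D u\<close> automatically form a nonexpanding
  map.\<close>

lemma colimit_factor:
  assumes inacc: "inaccessible |UNIV :: 'u set|"
    and colim: "met_colimit I r D \<phi> C c"
    and X: "|pts X| <o \<mu>" and h: "h \<in> met_hom X C"
  obtains i g where "i \<in> I" "g \<in> met_hom X (D i)" "compose (pts X) (c i) g = h"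
proof -
  have "\<forall>x\<in>pts X. \<exists>i. i \<in> I \<and> h x \<in> c i ` pts (D i)"
    using met_hom_pts[OF h] colimit_surj[OF colim] by blast
  then obtain i where i: "\<And>x. x \<in> pts X \<Longrightarrow> i x \<in> I \<and> h x \<in> c (i x) ` pts (D (i x))"
    by metis
  have "i ` pts X \<subseteq> I" "|i ` pts X| <o \<mu>"
    using i X by (auto intro: card_less_image)
  from upper_bound[OF this] obtain u where u: "u \<in> I" "\<And>x. x \<in> pts X \<Longrightarrow> (i x, u) \<in> r"
    by auto
  have iso: "isometry (D u) C (c u)"
    using colimit_isometry[OF inacc colim u(1)] .
  have "h x \<in> c u ` pts (D u)" if x: "x \<in> pts X" for x
  proof -
    obtain y where y: "y \<in> pts (D (i x))" "h x = c (i x) y"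
      using i[OF x] by blast
    have "compose (pts (D (i x))) (c u) (\<phi> (i x) u) = c (i x)"
      using colim u(2)[OF x] by (auto simp: met_colimit_def met_cocone_def)
    then have "h x = c u (\<phi> (i x) u y)"
      using y by (metis compose_eq)
    then show ?thesis
      using \<phi>_pts[OF u(2)[OF x] y(1)] by blast
  qed
  then have "\<forall>x\<in>pts X. \<exists>y. y \<in> pts (D u) \<and> h x = c u y"
    by blast
  then obtain g\<^sub>0 where g\<^sub>0: "\<And>x. x \<in> pts X \<Longrightarrow> g\<^sub>0 x \<in> pts (D u) \<and> h x = c u (g\<^sub>0 x)"
    by metis
  define g where "g = restrict g\<^sub>0 (pts X)"
  have g: "g x \<in> pts (D u)" "h x = c u (g x)" if "x \<in> pts X" for x
    using g\<^sub>0 that by (auto simp: g_def)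
  have g_hom: "g \<in> met_hom X (D u)"
  proof (rule met_homI)
    fix x y assume "x \<in> pts X" "y \<in> pts X"
    then show "edist (D u) (g x) (g y) \<le> edist X x y"
      using met_hom_nonexpanding[OF h] g isometry_edist[OF iso] by metis
  qed (use g in \<open>auto simp: g_def\<close>)
  have "compose (pts X) (c u) g = h"
    using met_hom_compose[OF g_hom isometry_met_hom[OF iso]] h g
    by (intro met_hom_eqI) (auto simp: compose_eq)
  then show thesis
    using that u(1) g_hom by blast
qed

text \<open>The usual description of directed colimits of sets: every map from \<open>X\<close> into
  the colimit factors through a stage, and two factorisations of the same map become equal at a
  later stage.\<close>

lemma hom_colimit:
  assumes inacc: "inaccessible |UNIV :: 'u set|"
    and colim: "met_colimit I r D \<phi> C c"
    and X: "|pts X| <o \<mu>"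
  shows "set_colimit I r (\<lambda>i. met_hom X (D i)) (\<lambda>i j. hom_map X (D i) (\<phi> i j))
          (met_hom X C) (\<lambda>i. hom_map X (D i) (c i))"
  unfolding set_colimit_def
proof (intro conjI allI impI; (elim conjE)?)
  have c: "c i \<in> met_hom (D i) C" if "i \<in> I" for i
    using isometry_met_hom[OF colimit_isometry[OF inacc colim that]] .
  have c_\<phi>: "c j (\<phi> i j x) = c i x" if "(i, j) \<in> r" "x \<in> pts (D i)" for i j x
  proof -
    have "compose (pts (D i)) (c j) (\<phi> i j) = c i"
      using colim that(1) by (auto simp: met_colimit_def met_cocone_def)
    then show ?thesis
      using that(2) by (metis compose_eq)
  qed
  have c_\<phi>_comp: "compose (pts X) (c j) (compose (pts X) (\<phi> i j) g) = compose (pts X) (c i) g"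
    if "(i, j) \<in> r" "g \<in> met_hom X (D i)" for i j g
    using c_\<phi>[OF that(1) met_hom_pts[OF that(2)]] by (auto simp: compose_def)
  have \<phi>_g: "compose (pts X) (\<phi> i j) g \<in> met_hom X (D j)"
    if "(i, j) \<in> r" "g \<in> met_hom X (D i)" for i j g
    using met_hom_compose[OF that(2) isometry_met_hom[OF \<phi>_isometry[OF that(1)]]] .
  show "set_cocone I r (\<lambda>i. met_hom X (D i)) (\<lambda>i j. hom_map X (D i) (\<phi> i j))
          (met_hom X C) (\<lambda>i. hom_map X (D i) (c i))"
    unfolding set_cocone_def
  proof (intro conjI ballI)
    fix i assume "i \<in> I"
    then show "hom_map X (D i) (c i) \<in> met_hom X (D i) \<rightarrow>\<^sub>E met_hom X C"
      using met_hom_compose[OF _ c] by (auto simp: hom_map_def)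
  next
    fix p assume p: "p \<in> r"
    obtain i j where "p = (i, j)"
      by (cases p)
    with p show "case p of (i, j) \<Rightarrow> compose (met_hom X (D i)) (hom_map X (D j) (c j))
      (hom_map X (D i) (\<phi> i j)) = hom_map X (D i) (c i)"
      using \<phi>_g c_\<phi>_comp by (auto simp: compose_def[of "met_hom X (D i)"] hom_map_def fun_eq_iff)
  qed
  fix Z z
  assume "small (Z :: 'u set)"
    and z: "set_cocone I r (\<lambda>i. met_hom X (D i)) (\<lambda>i j. hom_map X (D i) (\<phi> i j)) Z z"
  have zZ: "z i g \<in> Z" if "i \<in> I" "g \<in> met_hom X (D i)" for i g
    using z that by (auto simp: set_cocone_def)
  have z_\<phi>: "z j (compose (pts X) (\<phi> i j) g) = z i g" if "(i, j) \<in> r" "g \<in> met_hom X (D i)" for i j g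
  proof -
    have "compose (met_hom X (D i)) (z j) (hom_map X (D i) (\<phi> i j)) = z i"
      using z that(1) by (auto simp: set_cocone_def)
    from fun_cong[OF this, of g] that(2) show ?thesis
      by (simp add: compose_eq hom_map_def)
  qed
  \<comment> \<open>The two factorisations are compared at a common later stage \<open>k\<close>,
    whose leg is injective because it is an isometry.\<close>
  have wd: "z i g = z j g'"
    if ij: "i \<in> I" "j \<in> I" and g: "g \<in> met_hom X (D i)" and g': "g' \<in> met_hom X (D j)"
      and eq: "compose (pts X) (c i) g = compose (pts X) (c j) g'" for i j g g'
  proof -
    obtain k where k: "k \<in> I" "(i, k) \<in> r" "(j, k) \<in> r"
      using upper_bound2 ij by blast
    have inj: "inj_on (c k) (pts (D k))"
      using isometry_inj[OF colimit_isometry[OF inacc colim k(1)] D_emetric[OF k(1)]] colim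
      by (simp add: met_colimit_def met_cocone_def Met_def)
    have "compose (pts X) (\<phi> i k) g = compose (pts X) (\<phi> j k) g'"
    proof (rule met_hom_eqI[OF \<phi>_g[OF k(2) g] \<phi>_g[OF k(3) g']])
      fix x assume x: "x \<in> pts X"
      have "c i (g x) = c j (g' x)"
        using fun_cong[OF eq, of x] x by (simp add: compose_eq)
      then have "c k (\<phi> i k (g x)) = c k (\<phi> j k (g' x))"
        using c_\<phi> k x g g' by (simp add: met_hom_pts)
      then show "compose (pts X) (\<phi> i k) g x = compose (pts X) (\<phi> j k) g' x"
        using inj_onD[OF inj] \<phi>_pts k x g g' by (simp add: met_hom_pts compose_eq)
    qed
    then show ?thesis
      using z_\<phi>[OF k(2) g] z_\<phi>[OF k(3) g'] by simp
  qed
  define rep where "rep h = (SOME (i, g). i \<in> I \<and> g \<in> met_hom X (D i) \<and> compose (pts X) (c i) g = h)" for h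
  have rep: "fst (rep h) \<in> I" "snd (rep h) \<in> met_hom X (D (fst (rep h)))"
      "compose (pts X) (c (fst (rep h))) (snd (rep h)) = h"
    if h: "h \<in> met_hom X C" for h
  proof -
    obtain i g where "i \<in> I" "g \<in> met_hom X (D i)" "compose (pts X) (c i) g = h"
      using colimit_factor[OF inacc colim X h] .
    then have "\<exists>p. case p of (i, g) \<Rightarrow> i \<in> I \<and> g \<in> met_hom X (D i) \<and> compose (pts X) (c i) g = h"
      by auto
    from someI_ex[OF this] show "fst (rep h) \<in> I" "snd (rep h) \<in> met_hom X (D (fst (rep h)))"
      "compose (pts X) (c (fst (rep h))) (snd (rep h)) = h"
      by (auto simp: rep_def case_prod_unfold)
  qed
  define H where "H = (\<lambda>h\<in>met_hom X C. z (fst (rep h)) (snd (rep h)))"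
  have H_c: "H (compose (pts X) (c i) g) = z i g" if "i \<in> I" "g \<in> met_hom X (D i)" for i g
    using wd[OF rep(1) that(1) rep(2) that(2) rep(3)] met_hom_compose[OF that(2) c[OF that(1)]]
    by (simp add: H_def)
  show "\<exists>!h. h \<in> met_hom X C \<rightarrow>\<^sub>E Z \<and>
      (\<forall>i\<in>I. compose (met_hom X (D i)) h (hom_map X (D i) (c i)) = z i)"
  proof (rule ex1I[of _ H])
    have "compose (met_hom X (D i)) H (hom_map X (D i) (c i)) = z i" if "i \<in> I" for i
    proof (rule extensionalityI)
      show "z i \<in> extensional (met_hom X (D i))"
        using z that unfolding set_cocone_def by (blast dest: PiE_iff[THEN iffD1])
    qed (use that H_c in \<open>auto simp: compose_eq hom_map_def\<close>)
    then show "H \<in> met_hom X C \<rightarrow>\<^sub>E Z \<and>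
        (\<forall>i\<in>I. compose (met_hom X (D i)) H (hom_map X (D i) (c i)) = z i)"
      using zZ rep by (auto simp: H_def)
  next
    fix H' assume H': "H' \<in> met_hom X C \<rightarrow>\<^sub>E Z \<and>
        (\<forall>i\<in>I. compose (met_hom X (D i)) H' (hom_map X (D i) (c i)) = z i)"
    show "H' = H"
    proof (rule extensionalityI)
      fix h assume h: "h \<in> met_hom X C"
      obtain i g where ig: "i \<in> I" "g \<in> met_hom X (D i)" "compose (pts X) (c i) g = h"
        using colimit_factor[OF inacc colim X h] .
      have "compose (met_hom X (D i)) H' (hom_map X (D i) (c i)) = z i"
        using H' ig(1) by blast
      from fun_cong[OF this, of g] have "H' h = z i g"
        using ig by (simp add: compose_eq hom_map_def)
      then show "H' h = H h"
        using H_c ig by metis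
    qed (use H' in \<open>auto simp: H_def PiE_iff\<close>)
  qed
qed

end

section \<open>Spaces that are generated with respect to isometries\<close>

lemma card_less_imp_mu_generated:
  fixes X :: "'u emet"
  assumes "inaccessible |UNIV :: 'u set|" "Cinfinite \<mu>" "X \<in> Met" "|pts X| <o \<mu>"
  shows "mu_generated \<mu> X"
  unfolding mu_generated_def
proof (intro conjI allI impI; (elim conjE)?)
  fix I r D \<phi> and C :: "'u emet" and c
  assume d: "directed_inj_diagram \<mu> I r D \<phi>" and c: "met_colimit I r D \<phi> C c"
  interpret inj_diagram \<mu> I r D \<phi>
    using d assms(2) by unfold_locales
  show "set_colimit I r (\<lambda>i. met_hom X (D i)) (\<lambda>i j. hom_map X (D i) (\<phi> i j))
          (met_hom X C) (\<lambda>i. hom_map X (D i) (c i))"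
    using hom_colimit[OF assms(1) c assms(4)] .
qed fact

text \<open>
  A space is the \<open>\<mu>\<close>-directed union of its subspaces with less than \<open>\<mu>\<close> points; if it is
  \<open>\<mu>\<close>-generated, then its identity factors through one of them.
\<close>

lemma mu_generated_imp_card_less:
  fixes X :: "'u emet"
  assumes inacc: "inaccessible |UNIV :: 'u set|" and mu: "Cinfinite \<mu>" "regularCard \<mu>"
    and gen: "mu_generated \<mu> X"
  shows "|pts X| <o \<mu>"
proof -
  have X: "X \<in> Met" "emetric X" "small (pts X)"
    using gen by (auto simp: mu_generated_def Met_def)
  have Pow: "|Pow (pts X)| <o |UNIV :: 'u set|"
    using inacc X(3) by (simp add: card_less_Pow small_def)
  \<comment> \<open>Diagrams are indexed by elements of the universe type, so subsets of the space
    serve as indices through an injective code.\<close>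
  then obtain code :: "'u set \<Rightarrow> 'u" where code: "inj_on code (Pow (pts X))"
    by (rule card_less_inj_into_UNIV)
  define dec where "dec = inv_into (Pow (pts X)) code"
  have dec: "dec (code S) = S" if "S \<subseteq> pts X" for S
    using code that by (simp add: dec_def)
  define \<S> where "\<S> = {S. S \<subseteq> pts X \<and> |S| <o \<mu>}"
  define I where "I = code ` \<S>"
  have I: "dec i \<subseteq> pts X" "|dec i| <o \<mu>" "code (dec i) = i" if "i \<in> I" for i
    using that dec by (auto simp: I_def \<S>_def)
  have code_I: "code S \<in> I" if "S \<subseteq> pts X" "|S| <o \<mu>" for S
    using that by (auto simp: I_def \<S>_def)
  define r where "r = {(i, j). i \<in> I \<and> j \<in> I \<and> dec i \<subseteq> dec j}"
  define D where "D i = \<lparr>pts = dec i, edist = edist X\<rparr>" for i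
  \<comment> \<open>An extensional function does not record its codomain: \<open>c i\<close> is the
    inclusion of stage \<open>i\<close> into every larger stage and also into \<open>X\<close>, and
    serves both as connecting map and as leg.\<close>
  define c where "c i = (\<lambda>x\<in>dec i. x)" for i
  have "small I"
    unfolding small_def I_def
    using card_less_image[OF card_less_subset[OF _ Pow, of \<S>]] by (auto simp: \<S>_def)
  moreover have "mu_directed \<mu> I r"
  proof -
    have "partial_order_on I r"
      unfolding partial_order_on_def preorder_on_def
    proof (intro conjI)
      show "antisym r"
        using I(3) by (auto simp: r_def antisym_def) (metis subset_antisym)
    qed (auto simp: r_def refl_on_def trans_def)
    moreover have "\<exists>u\<in>I. \<forall>j\<in>J. (j, u) \<in> r" if J: "J \<subseteq> I" "|J| <o \<mu>" for J
    proof (intro bexI ballI)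
      have U: "(\<Union>j\<in>J. dec j) \<subseteq> pts X" "|\<Union>j\<in>J. dec j| <o \<mu>"
        using I J by (blast, auto intro!: card_less_UN mu)
      then show *: "code (\<Union>j\<in>J. dec j) \<in> I"
        by (rule code_I)
      fix j assume "j \<in> J"
      then show "(j, code (\<Union>j\<in>J. dec j)) \<in> r"
        using * J U(1) by (auto simp: r_def dec)
    qed
    ultimately show ?thesis
      by (simp add: mu_directed_def)
  qed
  ultimately have diagram: "directed_inj_diagram \<mu> I r D (\<lambda>i j. c i)"
    using I(1) X(1) unfolding directed_inj_diagram_def
    by (auto simp: D_def c_def r_def isometry_def id_hom_def compose_def
        intro!: Met_subset met_homI restrict_ext)
  have "met_cocone I r D (\<lambda>i j. c i) X c"
    using I(1)[THEN subsetD] X(1) unfolding met_cocone_def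
    by (auto simp: D_def c_def r_def compose_def intro!: met_homI restrict_ext dest: subsetD)
  moreover have "\<exists>!h. h \<in> met_hom X E \<and> (\<forall>i\<in>I. compose (pts (D i)) h (c i) = e i)"
    if E: "met_cocone I r D (\<lambda>i j. c i) E e" for E e
  proof -
    have e: "e i \<in> met_hom (D i) E" if "i \<in> I" for i
      using E that by (simp add: met_cocone_def)
    have e_c: "e j x = e i x" if "(i, j) \<in> r" "x \<in> dec i" for i j x
    proof -
      have "compose (pts (D i)) (e j) (c i) = e i"
        using E that(1) by (auto simp: met_cocone_def)
      from fun_cong[OF this, of x] show ?thesis
        using that(2) by (simp add: compose_def D_def c_def)
    qed
    have fin: "code S \<in> I" "dec (code S) = S" if "finite S" "S \<subseteq> pts X" for S
      using that by (auto intro!: code_I dec card_less_finite[OF mu(1)])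
    \<comment> \<open>Every point lies in the stage given by its singleton, and any two points share
      a finite stage, from which nonexpansion is read off.\<close>
    define h where "h = (\<lambda>x\<in>pts X. e (code {x}) x)"
    have h_e: "h x = e i x" if "i \<in> I" "x \<in> dec i" for i x
      using that I(1) fin[of "{x}"] e_c[of "code {x}" i x] by (auto simp: h_def r_def)
    show ?thesis
    proof (rule ex1I[of _ h])
      have "h \<in> met_hom X E"
      proof (rule met_homI)
        fix x y assume xy: "x \<in> pts X" "y \<in> pts X"
        define i where "i = code {x, y}"
        have i: "i \<in> I" "dec i = {x, y}"
          using fin[of "{x, y}"] xy by (auto simp: i_def)
        show "edist E (h x) (h y) \<le> edist X x y"
          using met_hom_nonexpanding[OF e[OF i(1)], of x y] i h_e[OF i(1)] by (simp add: D_def)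
        show "h x \<in> pts E"
          using met_hom_pts[OF e[OF i(1)], of x] i h_e[OF i(1)] by (simp add: D_def)
      qed (simp add: h_def)
      moreover have "compose (pts (D i)) h (c i) = e i" if "i \<in> I" for i
        by (rule extensionalityI[of _ "dec i"])
          (use met_hom_extensional[OF e[OF that]] h_e[OF that] in
            \<open>auto simp: compose_def D_def c_def\<close>)
      ultimately show "h \<in> met_hom X E \<and> (\<forall>i\<in>I. compose (pts (D i)) h (c i) = e i)"
        by blast
    next
      fix h' assume h': "h' \<in> met_hom X E \<and> (\<forall>i\<in>I. compose (pts (D i)) h' (c i) = e i)"
      show "h' = h"
      proof (rule extensionalityI)
        fix x assume x: "x \<in> pts X"
        have "compose (pts (D (code {x}))) h' (c (code {x})) = e (code {x})"
          using h' fin[of "{x}"] x by blast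
        from fun_cong[OF this, of x] show "h' x = h x"
          using x by (simp add: compose_def D_def c_def dec h_def)
      qed (use h' in \<open>auto simp: h_def dest: met_hom_extensional\<close>)
    qed
  qed
  ultimately have "met_colimit I r D (\<lambda>i j. c i) X c"
    by (simp add: met_colimit_def)
  with gen diagram have colim: "set_colimit I r (\<lambda>i. met_hom X (D i)) (\<lambda>i j. hom_map X (D i) (c i))
          (met_hom X X) (\<lambda>i. hom_map X (D i) (c i))"
    unfolding mu_generated_def by blast
  show ?thesis
  proof (rule ccontr)
    assume not_less: "\<not> |pts X| <o \<mu>"
    have "infinite (UNIV :: 'u set)"
      using inaccessible_Cinfinite[OF inacc] by (simp add: cinfinite_def Field_card_of)
    then obtain a b :: 'u where ab: "a \<noteq> b"
      by (metis (full_types) UNIV_eq_I finite.emptyI finite.insertI insertI1)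
    \<comment> \<open>That some stage reaches the identity is extracted from uniqueness. Otherwise
      \<open>H a\<close> and \<open>H b\<close>, which differ only at the identity, would both
      mediate the constant cocone \<open>z\<close> into a two-element set.\<close>
    define z where "z i = (\<lambda>g\<in>met_hom X (D i). a)" for i :: 'u
    define H where "H b = (\<lambda>h\<in>met_hom X X. if h = id_hom X then b else a)" for b :: 'u
    have cg: "compose (pts X) (c i) g \<in> met_hom X X" "compose (pts X) (c i) g \<noteq> id_hom X"
      if i: "i \<in> I" and g: "g \<in> met_hom X (D i)" for i g
    proof -
      have ci: "c i \<in> met_hom (D i) X"
        using I(1)[OF i] by (auto simp: c_def D_def intro!: met_homI)
      then show "compose (pts X) (c i) g \<in> met_hom X X"
        by (rule met_hom_compose[OF g])
      show "compose (pts X) (c i) g \<noteq> id_hom X"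
      proof
        assume eq: "compose (pts X) (c i) g = id_hom X"
        have "x \<in> dec i" if "x \<in> pts X" for x
          using fun_cong[OF eq, of x] met_hom_pts[OF g that] that
          by (simp add: compose_eq id_hom_def c_def D_def)
        then show False
          using not_less card_less_subset[OF subsetI I(2)[OF i]] by blast
      qed
    qed
    have H: "H b \<in> met_hom X X \<rightarrow>\<^sub>E {a, b} \<and>
        (\<forall>i\<in>I. compose (met_hom X (D i)) (H b) (hom_map X (D i) (c i)) = z i)"
      if "b \<in> {a, b}" for b
      using cg that by (auto simp: H_def z_def hom_map_def compose_def)
    have "z i \<in> met_hom X (D i) \<rightarrow>\<^sub>E {a, b}" for i
      by (auto simp: z_def)
    moreover have "compose (met_hom X (D i)) (z j) (hom_map X (D i) (c i)) = z i"
      if "(i, j) \<in> r" for i j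
    proof -
      have "compose (pts X) (c i) g \<in> met_hom X (D j)" if "g \<in> met_hom X (D i)" for g
        using diagram \<open>(i, j) \<in> r\<close> met_hom_compose[OF that] isometry_met_hom
        by (fastforce simp: directed_inj_diagram_def)
      then show ?thesis
        by (auto simp: z_def hom_map_def compose_def)
    qed
    ultimately have "set_cocone I r (\<lambda>i. met_hom X (D i)) (\<lambda>i j. hom_map X (D i) (c i)) {a, b} z"
      by (auto simp: set_cocone_def)
    moreover have "small {a, b}"
      by (simp add: small_def card_less_finite[OF inaccessible_Cinfinite[OF inacc]])
    ultimately have "\<exists>!h. h \<in> met_hom X X \<rightarrow>\<^sub>E {a, b} \<and>
        (\<forall>i\<in>I. compose (met_hom X (D i)) h (hom_map X (D i) (c i)) = z i)"
      using colim unfolding set_colimit_def by blast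
    moreover have "H a \<in> met_hom X X \<rightarrow>\<^sub>E {a, b}"
      by (auto simp: H_def)
    ultimately have "H a = H b"
      using H[of a] H[of b] by blast
    from fun_cong[OF this, of "id_hom X"] ab show False
      by (simp add: H_def id_hom_met_hom)
  qed
qed

section \<open>Quantitative algebras\<close>

text \<open>The conditions on an algebra other than smallness; they also make sense for a product,
  which lives over a function type.\<close>

definition qalgebra :: "'s signature \<Rightarrow> ('s, 'a) qalg \<Rightarrow> bool" where
  "qalgebra \<Sigma> A \<longleftrightarrow> emetric (U0 A) \<and>
     (\<forall>f\<in>syms \<Sigma>. opn A f \<in> met_hom (met_power (arity \<Sigma> f) (U0 A)) (U0 A))"

lemma Alg_iff: "A \<in> Alg \<Sigma> \<longleftrightarrow> qalgebra \<Sigma> A \<and> small (pts (U0 A))"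
  by (auto simp: Alg_def qalgebra_def Met_def)

lemma pts_met_prod [simp]: "pts (met_prod I X) = (\<Pi>\<^sub>E i\<in>I. pts (X i))"
  by (simp add: met_prod_def)

lemma edist_met_prod: "edist (met_prod I X) x y = (SUP i\<in>I. edist (X i) (x i) (y i))"
  by (simp add: met_prod_def)

lemma pts_met_power [simp]: "pts (met_power n X) = idx n \<rightarrow>\<^sub>E pts X"
  by (simp add: met_power_def)

lemma edist_met_power: "edist (met_power n X) x y = (SUP i\<in>idx n. edist X (x i) (y i))"
  by (simp add: met_power_def edist_met_prod)

lemma qalgebra_emetric: "qalgebra \<Sigma> A \<Longrightarrow> emetric (U0 A)"
  by (simp add: qalgebra_def)

lemma qalgebra_opn:
  "\<lbrakk>qalgebra \<Sigma> A; f \<in> syms \<Sigma>\<rbrakk> \<Longrightarrow> opn A f \<in> met_hom (met_power (arity \<Sigma> f) (U0 A)) (U0 A)"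
  by (simp add: qalgebra_def)

lemma opn_pts:
  "\<lbrakk>qalgebra \<Sigma> A; f \<in> syms \<Sigma>; a \<in> idx (arity \<Sigma> f) \<rightarrow>\<^sub>E pts (U0 A)\<rbrakk> \<Longrightarrow> opn A f a \<in> pts (U0 A)"
  using met_hom_pts[OF qalgebra_opn] by simp

lemma alg_homI:
  assumes "h \<in> met_hom (U0 A) (U0 B)"
    and "\<And>f a. \<lbrakk>f \<in> syms \<Sigma>; a \<in> idx (arity \<Sigma> f) \<rightarrow>\<^sub>E pts (U0 A)\<rbrakk> \<Longrightarrow>
       h (opn A f a) = opn B f (\<lambda>k\<in>idx (arity \<Sigma> f). h (a k))"
  shows "h \<in> alg_hom \<Sigma> A B"
  using assms by (auto simp: alg_hom_def compose_def)

lemma alg_hom_met_hom: "h \<in> alg_hom \<Sigma> A B \<Longrightarrow> h \<in> met_hom (U0 A) (U0 B)"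
  by (simp add: alg_hom_def)

lemma alg_hom_opn:
  "\<lbrakk>h \<in> alg_hom \<Sigma> A B; f \<in> syms \<Sigma>; a \<in> idx (arity \<Sigma> f) \<rightarrow>\<^sub>E pts (U0 A)\<rbrakk> \<Longrightarrow>
     h (opn A f a) = opn B f (\<lambda>k\<in>idx (arity \<Sigma> f). h (a k))"
  by (simp add: alg_hom_def compose_def)

lemma interp_pts:
  assumes "qalgebra \<Sigma> A" "\<And>v. v \<in> V \<Longrightarrow> a v \<in> pts (U0 A)" "t \<in> terms \<Sigma> V"
  shows "interp \<Sigma> A a t \<in> pts (U0 A)"
  using assms(3)
proof induction
  case (App f ts)
  then show ?case by (auto intro!: opn_pts[OF assms(1)])
qed (use assms(2) in simp)

lemma interp_hom:
  assumes "qalgebra \<Sigma> A" "h \<in> alg_hom \<Sigma> A B" "\<And>v. v \<in> V \<Longrightarrow> a v \<in> pts (U0 A)"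
    and "\<And>v. v \<in> V \<Longrightarrow> b v = h (a v)" "t \<in> terms \<Sigma> V"
  shows "h (interp \<Sigma> A a t) = interp \<Sigma> B b t"
  using assms(5)
proof induction
  case (App f ts)
  have "h (opn A f (\<lambda>i\<in>idx (arity \<Sigma> f). interp \<Sigma> A a (ts i))) =
      opn B f (\<lambda>i\<in>idx (arity \<Sigma> f). h ((\<lambda>i\<in>idx (arity \<Sigma> f). interp \<Sigma> A a (ts i)) i))"
    using App.hyps by (intro alg_hom_opn[OF assms(2)]) (auto intro!: interp_pts[OF assms(1,3)])
  also have "(\<lambda>i\<in>idx (arity \<Sigma> f). h ((\<lambda>i\<in>idx (arity \<Sigma> f). interp \<Sigma> A a (ts i)) i)) =
      (\<lambda>i\<in>idx (arity \<Sigma> f). interp \<Sigma> B b (ts i))"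
    using App.IH by (auto intro!: restrict_ext)
  finally show ?case
    by (simp only: interp.simps)
qed (use assms(4) in simp)

lemma interp_cong:
  assumes "\<And>v. v \<in> V \<Longrightarrow> a v = b v" "t \<in> terms \<Sigma> V"
  shows "interp \<Sigma> A a t = interp \<Sigma> A b t"
  using assms(2)
proof induction
  case (App f ts)
  then have "(\<lambda>i\<in>idx (arity \<Sigma> f). interp \<Sigma> A a (ts i)) = (\<lambda>i\<in>idx (arity \<Sigma> f). interp \<Sigma> A b (ts i))"
    by (auto intro!: restrict_ext)
  then show ?case by simp
qed (use assms(1) in simp)

section \<open>Terms: renaming, variables and the size of the set of terms\<close>

lemma App_terms_iff:
  "App f ts \<in> terms \<Sigma> V \<longleftrightarrow> f \<in> syms \<Sigma> \<and> ts \<in> extensional (idx (arity \<Sigma> f)) \<and>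
     (\<forall>i\<in>idx (arity \<Sigma> f). ts i \<in> terms \<Sigma> V)"
  by (subst terms.simps) auto

primrec rename :: "'s signature \<Rightarrow> ('v \<Rightarrow> 'w) \<Rightarrow> ('s, 'v) trm \<Rightarrow> ('s, 'w) trm" where
  "rename \<Sigma> g (Var v) = Var (g v)"
| "rename \<Sigma> g (App f ts) = App f (restrict (\<lambda>i. rename \<Sigma> g (ts i)) (idx (arity \<Sigma> f)))"

lemma rename_terms:
  assumes "t \<in> terms \<Sigma> V" "g ` V \<subseteq> W"
  shows "rename \<Sigma> g t \<in> terms \<Sigma> W"
  using assms(1) by induction (use assms(2) in \<open>auto intro: terms.intros\<close>)

lemma interp_rename: "interp \<Sigma> A a (rename \<Sigma> g t) = interp \<Sigma> A (\<lambda>v. a (g v)) t"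
proof (induction t)
  case (App f ts)
  then have "(\<lambda>i\<in>idx (arity \<Sigma> f). interp \<Sigma> A a ((\<lambda>i\<in>idx (arity \<Sigma> f). rename \<Sigma> g (ts i)) i)) =
      (\<lambda>i\<in>idx (arity \<Sigma> f). interp \<Sigma> A (\<lambda>v. a (g v)) (ts i))"
    by (auto intro!: restrict_ext)
  then show ?case by simp
qed simp

primrec vars :: "'s signature \<Rightarrow> ('s, 'v) trm \<Rightarrow> 'v set" where
  "vars \<Sigma> (Var v) = {v}"
| "vars \<Sigma> (App f ts) = (\<Union>i\<in>idx (arity \<Sigma> f). vars \<Sigma> (ts i))"

lemma vars_subset: "t \<in> terms \<Sigma> V \<Longrightarrow> vars \<Sigma> t \<subseteq> V"
  by (induction rule: terms.induct) auto

lemma terms_vars: "t \<in> terms \<Sigma> V \<Longrightarrow> vars \<Sigma> t \<subseteq> W \<Longrightarrow> t \<in> terms \<Sigma> W"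
  by (induction rule: terms.induct) (auto intro!: terms.intros)

lemma terms_mono: "t \<in> terms \<Sigma> V \<Longrightarrow> V \<subseteq> W \<Longrightarrow> t \<in> terms \<Sigma> W"
  using terms_vars[OF _ subset_trans[OF vars_subset]] .

text \<open>At an operation symbol fewer than \<mu> sets of size below \<mu> are united, which
  regularity of \<mu> allows.\<close>

lemma card_less_vars:
  assumes "Cinfinite \<mu>" "regularCard \<mu>" "mu_ary \<mu> \<Sigma>" "t \<in> terms \<Sigma> V"
  shows "|vars \<Sigma> t| <o \<mu>"
  using assms(4)
proof induction
  case (App f ts)
  then have "|\<Union>i\<in>idx (arity \<Sigma> f). vars \<Sigma> (ts i)| <o \<mu>"
    using assms(3) by (intro card_less_UN assms(1,2)) (auto simp: mu_ary_def)
  then show ?case by simp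
qed (simp add: card_less_finite[OF assms(1)])

text \<open>The labelled positions of a term; they encode a term by a subset of a small set.\<close>

primrec paths :: "'s signature \<Rightarrow> ('s, 'v) trm \<Rightarrow> (nat list \<times> ('s + 'v)) set" where
  "paths \<Sigma> (Var v) = {([], Inr v)}"
| "paths \<Sigma> (App f ts) = insert ([], Inl f)
     (\<Union>i\<in>idx (arity \<Sigma> f). (\<lambda>(p, l). (i # p, l)) ` paths \<Sigma> (ts i))"

lemma paths_subset: "t \<in> terms \<Sigma> V \<Longrightarrow> paths \<Sigma> t \<subseteq> UNIV \<times> (syms \<Sigma> <+> V)"
  by (induction rule: terms.induct) auto

text \<open>The label at the empty position determines the head of the term, and the positions
  starting with \<open>i\<close>, with \<open>i\<close> removed, are those of its
  \<open>i\<close>-th argument. Arguments outside the arity agree by extensionality.\<close>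

lemma paths_inj:
  assumes "t \<in> terms \<Sigma> V" "t' \<in> terms \<Sigma> V" "paths \<Sigma> t = paths \<Sigma> t'"
  shows "t = t'"
  using assms
proof (induction arbitrary: t' rule: terms.induct)
  case (Var v)
  then show ?case by (cases t') auto
next
  case (App f ts)
  from App.prems obtain g us where t': "t' = App g us"
    by (cases t') auto
  have "([], Inl f) \<in> paths \<Sigma> (App g us)"
    by (subst App.prems(2)[unfolded t', symmetric]) simp
  then have g: "g = f"
    by auto
  have us: "us \<in> extensional (idx (arity \<Sigma> f))" "\<And>i. i \<in> idx (arity \<Sigma> f) \<Longrightarrow> us i \<in> terms \<Sigma> V"
    using App.prems(1) unfolding t' g by (auto simp: App_terms_iff)
  have "ts = us"
  proof (rule extensionalityI[OF App.hyps(2) us(1)])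
    fix i assume i: "i \<in> idx (arity \<Sigma> f)"
    have paths_i: "paths \<Sigma> (ss i) = {(p, l). (i # p, l) \<in> paths \<Sigma> (App f ss)}"
      for ss :: "nat \<Rightarrow> ('a, 'b) trm"
      using i by (auto simp: image_iff) force
    have "paths \<Sigma> (ts i) = paths \<Sigma> (us i)"
      unfolding paths_i using App.prems(2) t' g by simp
    then show "ts i = us i"
      using App.IH i us(2) by blast
  qed
  then show ?case
    using t' g by simp
qed

lemma card_less_terms:
  fixes \<Sigma> :: "'s signature" and V :: "'v set"
  assumes inacc: "inaccessible |UNIV :: 'u set|"
    and "|syms \<Sigma>| <o |UNIV :: 'u set|" "|V| <o |UNIV :: 'u set|"
  shows "|terms \<Sigma> V| <o |UNIV :: 'u set|"
proof (rule card_less_inj)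
  show "inj_on (paths \<Sigma>) (terms \<Sigma> V)"
    by (rule inj_onI) (rule paths_inj)
  show "paths \<Sigma> ` terms \<Sigma> V \<subseteq> Pow (UNIV \<times> (syms \<Sigma> <+> V))"
    using paths_subset by blast
  show "|Pow ((UNIV :: nat list set) \<times> (syms \<Sigma> <+> V))| <o |UNIV :: 'u set|"
    using assms inaccessible_Cinfinite[OF inacc] inaccessible_regularCard[OF inacc]
      card_less_countable[OF inacc, of "UNIV :: nat list set"]
    by (intro card_less_Pow card_less_Sigma card_less_Plus) auto
qed


section \<open>Products, copies and subalgebras\<close>

lemma emetric_met_prod:
  assumes "\<And>i. i \<in> I \<Longrightarrow> emetric (X i)"
  shows "emetric (met_prod I X)"
  unfolding emetric_def edist_met_prod pts_met_prod
proof (intro conjI ballI)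
  fix x y assume x: "x \<in> (\<Pi>\<^sub>E i\<in>I. pts (X i))" and y: "y \<in> (\<Pi>\<^sub>E i\<in>I. pts (X i))"
  have "(SUP i\<in>I. edist (X i) (x i) (y i)) = 0 \<longleftrightarrow> (\<forall>i\<in>I. edist (X i) (x i) (y i) = 0)"
    by (simp flip: bot_ennreal)
  also have "\<dots> \<longleftrightarrow> (\<forall>i\<in>I. x i = y i)"
    using emetric_eq_0_iff[OF assms] x y by (auto simp: PiE_iff)
  also have "\<dots> \<longleftrightarrow> x = y"
    using PiE_ext[OF x y] by blast
  finally show "(SUP i\<in>I. edist (X i) (x i) (y i)) = 0 \<longleftrightarrow> x = y" .
  show "(SUP i\<in>I. edist (X i) (x i) (y i)) = (SUP i\<in>I. edist (X i) (y i) (x i))"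
    using emetric_commute[OF assms] x y by (auto intro!: SUP_cong simp: PiE_iff)
  fix z assume z: "z \<in> (\<Pi>\<^sub>E i\<in>I. pts (X i))"
  show "(SUP i\<in>I. edist (X i) (x i) (z i)) \<le>
      (SUP i\<in>I. edist (X i) (x i) (y i)) + (SUP i\<in>I. edist (X i) (y i) (z i))"
  proof (rule SUP_least)
    fix i assume i: "i \<in> I"
    have "edist (X i) (x i) (z i) \<le> edist (X i) (x i) (y i) + edist (X i) (y i) (z i)"
      using emetric_triangle[OF assms[OF i]] x y z i by (auto simp: PiE_iff)
    also have "\<dots> \<le> (SUP i\<in>I. edist (X i) (x i) (y i)) + (SUP i\<in>I. edist (X i) (y i) (z i))"
      using i by (intro add_mono SUP_upper)
    finally show "edist (X i) (x i) (z i) \<le> \<dots>" .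
  qed
qed

lemma U0_alg_prod [simp]: "U0 (alg_prod \<Sigma> I A) = met_prod I (\<lambda>i. U0 (A i))"
  by (simp add: alg_prod_def Let_def)

lemma opn_alg_prod:
  "a \<in> idx (arity \<Sigma> f) \<rightarrow>\<^sub>E (\<Pi>\<^sub>E i\<in>I. pts (U0 (A i))) \<Longrightarrow>
    opn (alg_prod \<Sigma> I A) f a = (\<lambda>i\<in>I. opn (A i) f (\<lambda>k\<in>idx (arity \<Sigma> f). a k i))"
  by (simp add: alg_prod_def Let_def)

lemma qalgebra_alg_prod:
  assumes A: "\<And>i. i \<in> I \<Longrightarrow> qalgebra \<Sigma> (A i)"
  shows "qalgebra \<Sigma> (alg_prod \<Sigma> I A)"
  unfolding qalgebra_def
proof (intro conjI ballI)
  show "emetric (U0 (alg_prod \<Sigma> I A))"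
    using A by (auto intro!: emetric_met_prod qalgebra_emetric)
  fix f assume f: "f \<in> syms \<Sigma>"
  show "opn (alg_prod \<Sigma> I A) f \<in>
    met_hom (met_power (arity \<Sigma> f) (U0 (alg_prod \<Sigma> I A))) (U0 (alg_prod \<Sigma> I A))"
  proof (rule met_homI; (unfold pts_met_power U0_alg_prod pts_met_prod)?)
    let ?P = "idx (arity \<Sigma> f) \<rightarrow>\<^sub>E (\<Pi>\<^sub>E i\<in>I. pts (U0 (A i)))"
    have a_i: "(\<lambda>k\<in>idx (arity \<Sigma> f). a k i) \<in> idx (arity \<Sigma> f) \<rightarrow>\<^sub>E pts (U0 (A i))"
      if "a \<in> ?P" "i \<in> I" for a i
      using that by (auto simp: PiE_iff)
    show "opn (alg_prod \<Sigma> I A) f \<in> extensional ?P"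
      by (simp add: alg_prod_def Let_def)
    show "opn (alg_prod \<Sigma> I A) f a \<in> (\<Pi>\<^sub>E i\<in>I. pts (U0 (A i)))" if a: "a \<in> ?P" for a
      using opn_pts[OF A f a_i[OF a]] by (simp add: opn_alg_prod[OF a])
    fix a b assume a: "a \<in> ?P" and b: "b \<in> ?P"
    show "edist (met_prod I (\<lambda>i. U0 (A i))) (opn (alg_prod \<Sigma> I A) f a) (opn (alg_prod \<Sigma> I A) f b)
      \<le> edist (met_power (arity \<Sigma> f) (met_prod I (\<lambda>i. U0 (A i)))) a b"
      unfolding edist_met_prod edist_met_power opn_alg_prod[OF a] opn_alg_prod[OF b]
    proof (rule SUP_least)
      fix i assume i: "i \<in> I"
      have "edist (U0 (A i)) (opn (A i) f (\<lambda>k\<in>idx (arity \<Sigma> f). a k i))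
          (opn (A i) f (\<lambda>k\<in>idx (arity \<Sigma> f). b k i))
        \<le> edist (met_power (arity \<Sigma> f) (U0 (A i))) (\<lambda>k\<in>idx (arity \<Sigma> f). a k i)
          (\<lambda>k\<in>idx (arity \<Sigma> f). b k i)"
        using met_hom_nonexpanding[OF qalgebra_opn[OF A[OF i] f]] a_i[OF a i] a_i[OF b i] by simp
      also have "\<dots> \<le> (SUP k\<in>idx (arity \<Sigma> f). SUP i\<in>I. edist (U0 (A i)) (a k i) (b k i))"
        unfolding edist_met_power using i
        by (auto intro!: SUP_mono SUP_upper2)
      finally show "edist (U0 (A i)) ((\<lambda>i\<in>I. opn (A i) f (\<lambda>k\<in>idx (arity \<Sigma> f). a k i)) i)
          ((\<lambda>i\<in>I. opn (A i) f (\<lambda>k\<in>idx (arity \<Sigma> f). b k i)) i)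
        \<le> (SUP k\<in>idx (arity \<Sigma> f). SUP i\<in>I. edist (U0 (A i)) (a k i) (b k i))"
        using i by simp
    qed
  qed
qed

lemma alg_prod_projection:
  assumes "i \<in> I" and A: "\<And>i. i \<in> I \<Longrightarrow> qalgebra \<Sigma> (A i)"
  shows "(\<lambda>x\<in>\<Pi>\<^sub>E i\<in>I. pts (U0 (A i)). x i) \<in> alg_hom \<Sigma> (alg_prod \<Sigma> I A) (A i)"
proof (rule alg_homI)
  show "(\<lambda>x\<in>\<Pi>\<^sub>E i\<in>I. pts (U0 (A i)). x i) \<in> met_hom (U0 (alg_prod \<Sigma> I A)) (U0 (A i))"
    using assms(1) by (intro met_homI) (auto simp: edist_met_prod intro!: SUP_upper)
  fix f a
  assume f: "f \<in> syms \<Sigma>" and a: "a \<in> idx (arity \<Sigma> f) \<rightarrow>\<^sub>E pts (U0 (alg_prod \<Sigma> I A))"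
  have "opn (alg_prod \<Sigma> I A) f a \<in> (\<Pi>\<^sub>E i\<in>I. pts (U0 (A i)))"
    using opn_pts[OF qalgebra_alg_prod f a] A by simp
  moreover have "(\<lambda>k\<in>idx (arity \<Sigma> f). (\<lambda>x\<in>\<Pi>\<^sub>E i\<in>I. pts (U0 (A i)). x i) (a k)) =
      (\<lambda>k\<in>idx (arity \<Sigma> f). a k i)"
    using PiE_mem[OF a] by (intro restrict_ext) simp
  ultimately show "(\<lambda>x\<in>\<Pi>\<^sub>E i\<in>I. pts (U0 (A i)). x i) (opn (alg_prod \<Sigma> I A) f a) =
      opn (A i) f (\<lambda>k\<in>idx (arity \<Sigma> f). (\<lambda>x\<in>\<Pi>\<^sub>E i\<in>I. pts (U0 (A i)). x i) (a k))"
    using a assms(1) by (simp add: opn_alg_prod)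
qed

definition alg_transport :: "'s signature \<Rightarrow> ('a \<Rightarrow> 'b) \<Rightarrow> ('s, 'a) qalg \<Rightarrow> ('s, 'b) qalg" where
  "alg_transport \<Sigma> g A = \<lparr>U0 = met_transport g (U0 A),
     opn = (\<lambda>f. \<lambda>a\<in>idx (arity \<Sigma> f) \<rightarrow>\<^sub>E g ` pts (U0 A).
       g (opn A f (\<lambda>k\<in>idx (arity \<Sigma> f). inv_into (pts (U0 A)) g (a k))))\<rparr>"

lemma U0_alg_transport [simp]: "U0 (alg_transport \<Sigma> g A) = met_transport g (U0 A)"
  by (simp add: alg_transport_def)

lemma opn_alg_transport:
  "a \<in> idx (arity \<Sigma> f) \<rightarrow>\<^sub>E g ` pts (U0 A) \<Longrightarrow>
    opn (alg_transport \<Sigma> g A) f a =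
      g (opn A f (\<lambda>k\<in>idx (arity \<Sigma> f). inv_into (pts (U0 A)) g (a k)))"
  by (simp add: alg_transport_def)

context
  fixes \<Sigma> :: "'s signature" and A :: "('s, 'a) qalg" and g :: "'a \<Rightarrow> 'b"
  assumes A: "qalgebra \<Sigma> A" and g: "inj_on g (pts (U0 A))"
begin

lemma inv_args:
  assumes "a \<in> idx n \<rightarrow>\<^sub>E g ` pts (U0 A)"
  shows "(\<lambda>k\<in>idx n. inv_into (pts (U0 A)) g (a k)) \<in> idx n \<rightarrow>\<^sub>E pts (U0 A)"
  using PiE_mem[OF assms] by (auto intro!: inv_into_into)

lemma qalgebra_alg_transport: "qalgebra \<Sigma> (alg_transport \<Sigma> g A)"
  unfolding qalgebra_def
proof (intro conjI ballI)
  show "emetric (U0 (alg_transport \<Sigma> g A))"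
    using emetric_transport[OF qalgebra_emetric[OF A] g] by simp
  fix f assume f: "f \<in> syms \<Sigma>"
  show "opn (alg_transport \<Sigma> g A) f \<in>
    met_hom (met_power (arity \<Sigma> f) (U0 (alg_transport \<Sigma> g A))) (U0 (alg_transport \<Sigma> g A))"
  proof (rule met_homI; (unfold pts_met_power U0_alg_transport pts_met_transport)?)
    let ?P = "idx (arity \<Sigma> f) \<rightarrow>\<^sub>E g ` pts (U0 A)"
    show "opn (alg_transport \<Sigma> g A) f \<in> extensional ?P"
      by (simp add: alg_transport_def)
    show "opn (alg_transport \<Sigma> g A) f a \<in> g ` pts (U0 A)" if a: "a \<in> ?P" for a
      unfolding opn_alg_transport[OF a] using opn_pts[OF A f inv_args[OF a]] by blast
    fix a b assume a: "a \<in> ?P" and b: "b \<in> ?P"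
    have "edist (met_transport g (U0 A)) (opn (alg_transport \<Sigma> g A) f a) (opn (alg_transport \<Sigma> g A) f b)
      = edist (U0 A) (opn A f (\<lambda>k\<in>idx (arity \<Sigma> f). inv_into (pts (U0 A)) g (a k)))
          (opn A f (\<lambda>k\<in>idx (arity \<Sigma> f). inv_into (pts (U0 A)) g (b k)))"
      unfolding opn_alg_transport[OF a] opn_alg_transport[OF b]
      using opn_pts[OF A f inv_args[OF a]] opn_pts[OF A f inv_args[OF b]] g by simp
    also have "\<dots> \<le> edist (met_power (arity \<Sigma> f) (U0 A))
        (\<lambda>k\<in>idx (arity \<Sigma> f). inv_into (pts (U0 A)) g (a k))
        (\<lambda>k\<in>idx (arity \<Sigma> f). inv_into (pts (U0 A)) g (b k))"
      using met_hom_nonexpanding[OF qalgebra_opn[OF A f]] inv_args[OF a] inv_args[OF b] by simp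
    also have "\<dots> = edist (met_power (arity \<Sigma> f) (met_transport g (U0 A))) a b"
      unfolding edist_met_power
      using PiE_mem[OF a] PiE_mem[OF b] by (intro SUP_cong) (auto simp: met_transport_def)
    finally show "edist (met_transport g (U0 A)) (opn (alg_transport \<Sigma> g A) f a)
        (opn (alg_transport \<Sigma> g A) f b)
      \<le> edist (met_power (arity \<Sigma> f) (met_transport g (U0 A))) a b" .
  qed
qed

lemma alg_transport_hom: "restrict g (pts (U0 A)) \<in> alg_hom \<Sigma> A (alg_transport \<Sigma> g A)"
proof (rule alg_homI)
  fix f a
  assume f: "f \<in> syms \<Sigma>" and a: "a \<in> idx (arity \<Sigma> f) \<rightarrow>\<^sub>E pts (U0 A)"
  have "(\<lambda>k\<in>idx (arity \<Sigma> f). inv_into (pts (U0 A)) g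
      ((\<lambda>k\<in>idx (arity \<Sigma> f). restrict g (pts (U0 A)) (a k)) k)) = (\<lambda>k\<in>idx (arity \<Sigma> f). a k)"
    using PiE_mem[OF a] g by (intro restrict_ext) simp
  also have "\<dots> = a"
    using a by (rule PiE_restrict)
  finally show "restrict g (pts (U0 A)) (opn A f a) =
    opn (alg_transport \<Sigma> g A) f (\<lambda>k\<in>idx (arity \<Sigma> f). restrict g (pts (U0 A)) (a k))"
    using opn_pts[OF A f a] PiE_mem[OF a] by (subst opn_alg_transport) auto
qed (use met_transport_hom[OF g] in simp)

lemma alg_transport_inv_hom:
  "restrict (inv_into (pts (U0 A)) g) (g ` pts (U0 A)) \<in> alg_hom \<Sigma> (alg_transport \<Sigma> g A) A"
proof (rule alg_homI)
  fix f a
  assume f: "f \<in> syms \<Sigma>" and "a \<in> idx (arity \<Sigma> f) \<rightarrow>\<^sub>E pts (U0 (alg_transport \<Sigma> g A))"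
  then have a: "a \<in> idx (arity \<Sigma> f) \<rightarrow>\<^sub>E g ` pts (U0 A)"
    by simp
  have "(\<lambda>k\<in>idx (arity \<Sigma> f). restrict (inv_into (pts (U0 A)) g) (g ` pts (U0 A)) (a k)) =
      (\<lambda>k\<in>idx (arity \<Sigma> f). inv_into (pts (U0 A)) g (a k))"
    using PiE_mem[OF a] by (intro restrict_ext) simp
  then show "restrict (inv_into (pts (U0 A)) g) (g ` pts (U0 A)) (opn (alg_transport \<Sigma> g A) f a) =
    opn A f (\<lambda>k\<in>idx (arity \<Sigma> f). restrict (inv_into (pts (U0 A)) g) (g ` pts (U0 A)) (a k))"
    using opn_pts[OF A f inv_args[OF a]] g by (simp add: opn_alg_transport[OF a])
qed (use met_transport_inv_hom[OF g] in simp)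

lemma alg_iso_transport: "alg_iso \<Sigma> A (alg_transport \<Sigma> g A)"
  unfolding alg_iso_def
proof (intro bexI conjI)
  show "compose (pts (U0 A)) (restrict (inv_into (pts (U0 A)) g) (g ` pts (U0 A)))
      (restrict g (pts (U0 A))) = id_hom (U0 A)"
    using g by (auto simp: compose_def id_hom_def)
  show "compose (pts (U0 (alg_transport \<Sigma> g A))) (restrict g (pts (U0 A)))
      (restrict (inv_into (pts (U0 A)) g) (g ` pts (U0 A))) = id_hom (U0 (alg_transport \<Sigma> g A))"
    by (auto simp: compose_def id_hom_def f_inv_into_f inv_into_into)
qed (fact alg_transport_hom alg_transport_inv_hom)+

end

definition subalgebra :: "'s signature \<Rightarrow> ('s, 'a) qalg \<Rightarrow> 'a set \<Rightarrow> ('s, 'a) qalg" where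
  "subalgebra \<Sigma> A S = \<lparr>U0 = \<lparr>pts = S, edist = edist (U0 A)\<rparr>,
     opn = (\<lambda>f. restrict (opn A f) (idx (arity \<Sigma> f) \<rightarrow>\<^sub>E S))\<rparr>"

lemma U0_subalgebra [simp]: "U0 (subalgebra \<Sigma> A S) = \<lparr>pts = S, edist = edist (U0 A)\<rparr>"
  by (simp add: subalgebra_def)

lemma opn_subalgebra:
  "a \<in> idx (arity \<Sigma> f) \<rightarrow>\<^sub>E S \<Longrightarrow> opn (subalgebra \<Sigma> A S) f a = opn A f a"
  by (simp add: subalgebra_def)

context
  fixes \<Sigma> :: "'s signature" and A :: "('s, 'a) qalg" and S :: "'a set"
  assumes A: "qalgebra \<Sigma> A" and S: "S \<subseteq> pts (U0 A)"
    and closed: "\<And>f a. \<lbrakk>f \<in> syms \<Sigma>; a \<in> idx (arity \<Sigma> f) \<rightarrow>\<^sub>E S\<rbrakk> \<Longrightarrow> opn A f a \<in> S"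
begin

lemma qalgebra_subalgebra: "qalgebra \<Sigma> (subalgebra \<Sigma> A S)"
  unfolding qalgebra_def
proof (intro conjI ballI)
  show "emetric (U0 (subalgebra \<Sigma> A S))"
    using emetric_subset[OF qalgebra_emetric[OF A] S] by simp
  fix f assume f: "f \<in> syms \<Sigma>"
  show "opn (subalgebra \<Sigma> A S) f \<in>
    met_hom (met_power (arity \<Sigma> f) (U0 (subalgebra \<Sigma> A S))) (U0 (subalgebra \<Sigma> A S))"
  proof (rule met_homI)
    fix a b assume "a \<in> pts (met_power (arity \<Sigma> f) (U0 (subalgebra \<Sigma> A S)))"
      and "b \<in> pts (met_power (arity \<Sigma> f) (U0 (subalgebra \<Sigma> A S)))"
    then have a: "a \<in> idx (arity \<Sigma> f) \<rightarrow>\<^sub>E S" and b: "b \<in> idx (arity \<Sigma> f) \<rightarrow>\<^sub>E S"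
      by simp_all
    then have "a \<in> idx (arity \<Sigma> f) \<rightarrow>\<^sub>E pts (U0 A)" "b \<in> idx (arity \<Sigma> f) \<rightarrow>\<^sub>E pts (U0 A)"
      using S by (auto simp: PiE_iff)
    then show "edist (U0 (subalgebra \<Sigma> A S)) (opn (subalgebra \<Sigma> A S) f a) (opn (subalgebra \<Sigma> A S) f b)
      \<le> edist (met_power (arity \<Sigma> f) (U0 (subalgebra \<Sigma> A S))) a b"
      using met_hom_nonexpanding[OF qalgebra_opn[OF A f], of a b] a b
      by (simp add: opn_subalgebra edist_met_power)
  qed (use closed[OF f] in \<open>auto simp: subalgebra_def\<close>)
qed

lemma subalgebra_hom: "(\<lambda>x\<in>S. x) \<in> alg_hom \<Sigma> (subalgebra \<Sigma> A S) A"
proof (rule alg_homI)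
  fix f a
  assume f: "f \<in> syms \<Sigma>" and "a \<in> idx (arity \<Sigma> f) \<rightarrow>\<^sub>E pts (U0 (subalgebra \<Sigma> A S))"
  then have a: "a \<in> idx (arity \<Sigma> f) \<rightarrow>\<^sub>E S"
    by simp
  have "(\<lambda>k\<in>idx (arity \<Sigma> f). (\<lambda>x\<in>S. x) (a k)) = (\<lambda>k\<in>idx (arity \<Sigma> f). a k)"
    using PiE_mem[OF a] by (intro restrict_ext) simp
  also have "\<dots> = a"
    using a by (rule PiE_restrict)
  finally show "(\<lambda>x\<in>S. x) (opn (subalgebra \<Sigma> A S) f a) =
      opn A f (\<lambda>k\<in>idx (arity \<Sigma> f). (\<lambda>x\<in>S. x) (a k))"
    using closed[OF f a] by (simp add: opn_subalgebra[OF a])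
qed (use S in \<open>auto intro!: met_homI\<close>)

lemma subalgebra_isometry: "isometry (U0 (subalgebra \<Sigma> A S)) (U0 A) (\<lambda>x\<in>S. x)"
  using alg_hom_met_hom[OF subalgebra_hom] by (simp add: isometry_def)

end

text \<open>A term is chosen for every argument, and the symbol is applied to these terms. This
  shows that the values of terms form a subalgebra, and it lets maps defined on values of terms be
  checked against the operations.\<close>

lemma generated_subset_closed:
  assumes A: "qalgebra \<Sigma> A" and f: "f \<in> syms \<Sigma>"
    and a: "a \<in> idx (arity \<Sigma> f) \<rightarrow>\<^sub>E interp \<Sigma> A \<alpha> ` terms \<Sigma> V"
  obtains ts where "App f ts \<in> terms \<Sigma> V" "interp \<Sigma> A \<alpha> (App f ts) = opn A f a"
    "\<And>k. k \<in> idx (arity \<Sigma> f) \<Longrightarrow> ts k \<in> terms \<Sigma> V \<and> interp \<Sigma> A \<alpha> (ts k) = a k"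
proof -
  have "\<forall>k\<in>idx (arity \<Sigma> f). \<exists>t. t \<in> terms \<Sigma> V \<and> interp \<Sigma> A \<alpha> t = a k"
    using PiE_mem[OF a] by fastforce
  then obtain ts\<^sub>0 where ts\<^sub>0: "\<And>k. k \<in> idx (arity \<Sigma> f) \<Longrightarrow> ts\<^sub>0 k \<in> terms \<Sigma> V \<and> interp \<Sigma> A \<alpha> (ts\<^sub>0 k) = a k"
    by metis
  define ts where "ts = restrict ts\<^sub>0 (idx (arity \<Sigma> f))"
  have ts: "ts k \<in> terms \<Sigma> V \<and> interp \<Sigma> A \<alpha> (ts k) = a k" if "k \<in> idx (arity \<Sigma> f)" for k
    using ts\<^sub>0[OF that] that by (simp add: ts_def)
  have "(\<lambda>k\<in>idx (arity \<Sigma> f). interp \<Sigma> A \<alpha> (ts k)) = (\<lambda>k\<in>idx (arity \<Sigma> f). a k)"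
    using ts by (intro restrict_ext) simp
  also have "\<dots> = a"
    using a by (rule PiE_restrict)
  finally have "interp \<Sigma> A \<alpha> (App f ts) = opn A f a"
    by simp
  moreover have "App f ts \<in> terms \<Sigma> V"
    using ts f by (auto simp: App_terms_iff ts_def)
  ultimately show thesis
    using that ts by blast
qed


section \<open>Satisfaction of equations\<close>

lemma satisfiesD:
  "\<lbrakk>satisfies \<Sigma> A e; a \<in> met_hom (ctxt e) (U0 A)\<rbrakk> \<Longrightarrow>
    edist (U0 A) (interp \<Sigma> A a (lhs e)) (interp \<Sigma> A a (rhs e)) \<le> ennreal (bnd e)"
  by (simp add: satisfies_def)

text \<open>The carrier types of \<open>A\<close> and \<open>B\<close> may differ, so this also
  passes from a product over a function type to its copy in the universe type.\<close>

lemma satisfies_subalgebra: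
  assumes A: "qalgebra \<Sigma> A" and g: "g \<in> alg_hom \<Sigma> A B" "isometry (U0 A) (U0 B) g"
    and e: "lhs e \<in> terms \<Sigma> (pts (ctxt e))" "rhs e \<in> terms \<Sigma> (pts (ctxt e))"
    and B: "satisfies \<Sigma> B e"
  shows "satisfies \<Sigma> A e"
  unfolding satisfies_def
proof
  fix a assume a: "a \<in> met_hom (ctxt e) (U0 A)"
  define b where "b = compose (pts (ctxt e)) g a"
  have b: "b \<in> met_hom (ctxt e) (U0 B)"
    unfolding b_def by (rule met_hom_compose[OF a alg_hom_met_hom[OF g(1)]])
  have g_interp: "g (interp \<Sigma> A a t) = interp \<Sigma> B b t" if "t \<in> terms \<Sigma> (pts (ctxt e))" for t
    using that by (intro interp_hom[OF A g(1)]) (auto simp: b_def compose_eq met_hom_pts[OF a])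
  have pts: "interp \<Sigma> A a t \<in> pts (U0 A)" if "t \<in> terms \<Sigma> (pts (ctxt e))" for t
    using that met_hom_pts[OF a] by (rule interp_pts[OF A, rotated])
  show "edist (U0 A) (interp \<Sigma> A a (lhs e)) (interp \<Sigma> A a (rhs e)) \<le> ennreal (bnd e)"
    using satisfiesD[OF B b] isometry_edist[OF g(2) pts[OF e(1)] pts[OF e(2)]]
    by (simp add: g_interp e)
qed

lemma satisfies_prod:
  assumes A: "\<And>i. i \<in> I \<Longrightarrow> qalgebra \<Sigma> (A i)" "\<And>i. i \<in> I \<Longrightarrow> satisfies \<Sigma> (A i) e"
    and e: "lhs e \<in> terms \<Sigma> (pts (ctxt e))" "rhs e \<in> terms \<Sigma> (pts (ctxt e))"
  shows "satisfies \<Sigma> (alg_prod \<Sigma> I A) e"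
  unfolding satisfies_def
proof
  let ?P = "alg_prod \<Sigma> I A"
  have P: "qalgebra \<Sigma> ?P"
    using A(1) by (rule qalgebra_alg_prod)
  fix a assume a: "a \<in> met_hom (ctxt e) (U0 ?P)"
  have pts: "interp \<Sigma> ?P a t \<in> pts (U0 ?P)" if "t \<in> terms \<Sigma> (pts (ctxt e))" for t
    using met_hom_pts[OF a] that by (rule interp_pts[OF P])
  show "edist (U0 ?P) (interp \<Sigma> ?P a (lhs e)) (interp \<Sigma> ?P a (rhs e)) \<le> ennreal (bnd e)"
    unfolding U0_alg_prod edist_met_prod
  proof (rule SUP_least)
    fix i assume i: "i \<in> I"
    define \<pi> where "\<pi> = (\<lambda>x\<in>\<Pi>\<^sub>E i\<in>I. pts (U0 (A i)). x i)"
    have \<pi>: "\<pi> \<in> alg_hom \<Sigma> ?P (A i)"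
      unfolding \<pi>_def using alg_prod_projection[OF i A(1)] .
    define b where "b = compose (pts (ctxt e)) \<pi> a"
    have b: "b \<in> met_hom (ctxt e) (U0 (A i))"
      unfolding b_def by (rule met_hom_compose[OF a alg_hom_met_hom[OF \<pi>]])
    have "interp \<Sigma> ?P a t i = interp \<Sigma> (A i) b t" if t: "t \<in> terms \<Sigma> (pts (ctxt e))" for t
    proof -
      have "\<pi> (interp \<Sigma> ?P a t) = interp \<Sigma> (A i) b t"
        using met_hom_pts[OF a] t
        by (intro interp_hom[OF P \<pi>]) (auto simp: b_def compose_eq)
      then show ?thesis
        using pts[OF t] by (simp add: \<pi>_def)
    qed
    then show "edist (U0 (A i)) (interp \<Sigma> ?P a (lhs e) i) (interp \<Sigma> ?P a (rhs e) i) \<le> ennreal (bnd e)"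
      using satisfiesD[OF A(2)[OF i] b] e by simp
  qed
qed

text \<open>The quotient enters only through the lifting of assignments of the one context; sections
  and \<mu>-purity both provide it.\<close>

lemma satisfies_quotient:
  assumes A: "qalgebra \<Sigma> A" and f: "f \<in> alg_hom \<Sigma> A B"
    and lift: "\<And>b. b \<in> met_hom (ctxt e) (U0 B) \<Longrightarrow>
      \<exists>a\<in>met_hom (ctxt e) (U0 A). compose (pts (ctxt e)) f a = b"
    and e: "lhs e \<in> terms \<Sigma> (pts (ctxt e))" "rhs e \<in> terms \<Sigma> (pts (ctxt e))"
    and sat: "satisfies \<Sigma> A e"
  shows "satisfies \<Sigma> B e"
  unfolding satisfies_def
proof
  fix b assume "b \<in> met_hom (ctxt e) (U0 B)"
  then obtain a where a: "a \<in> met_hom (ctxt e) (U0 A)" and b: "compose (pts (ctxt e)) f a = b"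
    using lift by blast
  have f_interp: "f (interp \<Sigma> A a t) = interp \<Sigma> B b t" if "t \<in> terms \<Sigma> (pts (ctxt e))" for t
    using that by (intro interp_hom[OF A f]) (auto simp: b[symmetric] compose_eq met_hom_pts[OF a])
  have pts: "interp \<Sigma> A a t \<in> pts (U0 A)" if "t \<in> terms \<Sigma> (pts (ctxt e))" for t
    using that met_hom_pts[OF a] by (rule interp_pts[OF A, rotated])
  have "edist (U0 B) (f (interp \<Sigma> A a (lhs e))) (f (interp \<Sigma> A a (rhs e)))
      \<le> edist (U0 A) (interp \<Sigma> A a (lhs e)) (interp \<Sigma> A a (rhs e))"
    by (rule met_hom_nonexpanding[OF alg_hom_met_hom[OF f] pts[OF e(1)] pts[OF e(2)]])
  also have "\<dots> \<le> ennreal (bnd e)"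
    by (rule satisfiesD[OF sat a])
  finally show "edist (U0 B) (interp \<Sigma> B b (lhs e)) (interp \<Sigma> B b (rhs e)) \<le> ennreal (bnd e)"
    by (simp add: f_interp e)
qed

text \<open>A nonexpanding map with a nonexpanding left inverse preserves distances. Closure under
  isomorphic copies, of members as well as of products, thereby becomes a case of closure under
  subalgebras.\<close>

lemma alg_iso_isometry:
  assumes "alg_iso \<Sigma> A B"
  obtains g where "g \<in> alg_hom \<Sigma> B A" "isometry (U0 B) (U0 A) g"
proof -
  obtain h g where h: "h \<in> alg_hom \<Sigma> A B" and g: "g \<in> alg_hom \<Sigma> B A"
    and hg: "compose (pts (U0 B)) h g = id_hom (U0 B)"
    using assms by (auto simp: alg_iso_def)
  have "isometry (U0 B) (U0 A) g"
    unfolding isometry_def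
  proof (intro conjI ballI)
    show g': "g \<in> met_hom (U0 B) (U0 A)"
      by (rule alg_hom_met_hom[OF g])
    fix x y assume x: "x \<in> pts (U0 B)" and y: "y \<in> pts (U0 B)"
    have "h (g x) = x" "h (g y) = y"
      using fun_cong[OF hg, of x] fun_cong[OF hg, of y] x y by (simp_all add: compose_eq id_hom_def)
    then have "edist (U0 B) x y \<le> edist (U0 A) (g x) (g y)"
      using met_hom_nonexpanding[OF alg_hom_met_hom[OF h] met_hom_pts[OF g' x] met_hom_pts[OF g' y]]
      by simp
    then show "edist (U0 A) (g x) (g y) = edist (U0 B) x y"
      using met_hom_nonexpanding[OF g' x y] by simp
  qed
  then show thesis
    using that g by blast
qed

lemma mu_basic_ctxt_generated:
  fixes e :: "('s, 'u) qeq"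
  assumes "inaccessible |UNIV :: 'u set|" "\<mu> =o natLeq \<or> \<mu> =o cardSuc natLeq" "mu_basic \<mu> \<Sigma> e"
  shows "mu_generated \<mu> (ctxt e)"
proof (rule card_less_imp_mu_generated)
  show "ctxt e \<in> Met"
    using assms(3)
    by (simp add: mu_basic_def Met_def small_def
        card_less_countable[OF assms(1) omega_or_omega1_countable[OF assms(2)]])
qed (use assms in \<open>simp_all add: omega_or_omega1_Cinfinite mu_basic_def\<close>)

section \<open>Closure properties of equational classes\<close>

lemma mu_surj_birkhoff_models:
  fixes T :: "('s, 'u) qeq set"
  assumes inacc: "inaccessible |UNIV :: 'u set|"
    and mu: "\<mu> =o natLeq \<or> \<mu> =o cardSuc natLeq"
    and T: "mu_basic_theory \<mu> \<Sigma> T"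
  shows "mu_surj_birkhoff \<mu> \<Sigma> (models \<Sigma> T)"
proof -
  have e: "mu_basic \<mu> \<Sigma> e" "lhs e \<in> terms \<Sigma> (pts (ctxt e))" "rhs e \<in> terms \<Sigma> (pts (ctxt e))"
    if "e \<in> T" for e
    using T that by (auto simp: mu_basic_theory_def mu_basic_def)
  have alg: "qalgebra \<Sigma> A" if "A \<in> Alg \<Sigma>" for A :: "('s, 'u) qalg"
    using that by (simp add: Alg_iff)
  have sub: "A \<in> models \<Sigma> T" if "A \<in> Alg \<Sigma>" "g \<in> alg_hom \<Sigma> A B" "isometry (U0 A) (U0 B) g"
    "\<forall>e\<in>T. satisfies \<Sigma> B e" for A g and B :: "('s, 'b) qalg"
    using that satisfies_subalgebra[OF alg[OF that(1)] that(2,3) e(2,3)] by (simp add: models_def)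
  have quot: "B \<in> models \<Sigma> T"
    if A: "A \<in> models \<Sigma> T" and B: "B \<in> Alg \<Sigma>" and f: "f \<in> alg_hom \<Sigma> A B"
      and "\<And>e b. \<lbrakk>e \<in> T; b \<in> met_hom (ctxt e) (U0 B)\<rbrakk> \<Longrightarrow>
        \<exists>a\<in>met_hom (ctxt e) (U0 A). compose (pts (ctxt e)) f a = b" for A B f
    using that(1,2) satisfies_quotient[OF alg f that(4) e(2,3)] by (simp add: models_def)
  have "replete \<Sigma> (models \<Sigma> T)"
    unfolding replete_def
  proof (intro ballI impI)
    fix A B :: "('s, 'u) qalg"
    assume A: "A \<in> models \<Sigma> T" and B: "B \<in> Alg \<Sigma>" and "alg_iso \<Sigma> A B"
    from alg_iso_isometry[OF this(3)] obtain g
      where g: "g \<in> alg_hom \<Sigma> B A" "isometry (U0 B) (U0 A) g" .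
    show "B \<in> models \<Sigma> T"
      by (rule sub[OF B g]) (use A in \<open>simp add: models_def\<close>)
  qed
  moreover have "closed_under_products \<Sigma> (models \<Sigma> T)"
    unfolding closed_under_products_def
  proof (intro allI impI ballI)
    fix I :: "'u set" and A :: "'u \<Rightarrow> ('s, 'u) qalg" and P :: "('s, 'u) qalg"
    assume A: "small I \<and> (\<forall>i\<in>I. A i \<in> models \<Sigma> T)" and P: "P \<in> Alg \<Sigma>"
      and "alg_iso \<Sigma> (alg_prod \<Sigma> I A) P"
    from alg_iso_isometry[OF this(3)] obtain g
      where g: "g \<in> alg_hom \<Sigma> P (alg_prod \<Sigma> I A)" "isometry (U0 P) (U0 (alg_prod \<Sigma> I A)) g" .
    have "satisfies \<Sigma> (alg_prod \<Sigma> I A) e" if "e \<in> T" for e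
      using A that by (intro satisfies_prod e(2,3)) (auto simp: models_def alg)
    then show "P \<in> models \<Sigma> T"
      using sub[OF P g] by blast
  qed
  moreover have "closed_under_inj_subalgebras \<Sigma> (models \<Sigma> T)"
    unfolding closed_under_inj_subalgebras_def using sub by (auto simp: models_def)
  moreover have "closed_under_split_quotients \<Sigma> (models \<Sigma> T)"
    unfolding closed_under_split_quotients_def
  proof (intro ballI impI)
    fix A B :: "('s, 'u) qalg" and f
    assume A: "A \<in> models \<Sigma> T" and B: "B \<in> Alg \<Sigma>" and f: "f \<in> alg_hom \<Sigma> A B"
      and "split_epi (U0 A) (U0 B) f"
    then obtain s where s: "s \<in> met_hom (U0 B) (U0 A)" "compose (pts (U0 B)) f s = id_hom (U0 B)"
      by (auto simp: split_epi_def)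
    have f_s: "f (s y) = y" if "y \<in> pts (U0 B)" for y
      using fun_cong[OF s(2), of y] that by (simp add: compose_eq id_hom_def)
    show "B \<in> models \<Sigma> T"
    proof (rule quot[OF A B f])
      fix e b assume "e \<in> T" and b: "b \<in> met_hom (ctxt e) (U0 B)"
      have "compose (pts (ctxt e)) f (compose (pts (ctxt e)) s b) = b"
        using b met_hom_pts[OF b]
        by (intro extensionalityI[OF _ met_hom_extensional[OF b]]) (auto simp: compose_eq f_s)
      then show "\<exists>a\<in>met_hom (ctxt e) (U0 A). compose (pts (ctxt e)) f a = b"
        using met_hom_compose[OF b s(1)] by blast
    qed
  qed
  moreover have "closed_under_pure_quotients \<mu> \<Sigma> (models \<Sigma> T)"
    unfolding closed_under_pure_quotients_def
  proof (intro ballI impI)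
    fix A B :: "('s, 'u) qalg" and f
    assume A: "A \<in> models \<Sigma> T" and B: "B \<in> Alg \<Sigma>" and f: "f \<in> alg_hom \<Sigma> A B"
      and "f ` pts (U0 A) = pts (U0 B) \<and> mu_pure_epi \<mu> (U0 A) (U0 B) f"
    then show "B \<in> models \<Sigma> T"
      using quot[OF A B f] mu_basic_ctxt_generated[OF inacc mu e(1)]
      by (simp add: mu_pure_epi_def)
  qed
  ultimately show ?thesis
    by (auto simp: mu_surj_birkhoff_def surj_birkhoff_def models_def)
qed


section \<open>The equational theory of a class of algebras\<close>

text \<open>
  Prescribing the junk values of the distance outside of the carrier makes the contexts with
  points in \<open>N\<close> a set rather than a class.
\<close>

definition normal_ctxts :: "'a set \<Rightarrow> 'a emet set" where
  "normal_ctxts N = {X. emetric X \<and> pts X \<subseteq> N \<and>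
     (\<forall>u v. u \<notin> pts X \<or> v \<notin> pts X \<longrightarrow> edist X u v = 0)}"

lemma met_transport_normal_ctxts:
  "\<lbrakk>emetric X; inj_on g (pts X); g ` pts X \<subseteq> N\<rbrakk> \<Longrightarrow> met_transport g X \<in> normal_ctxts N"
  by (auto simp: normal_ctxts_def emetric_transport) (auto simp: met_transport_def)

text \<open>A normalised context is coded by its carrier and by the graph of its distance on all of
  \<open>N\<close>; both range over small power sets.\<close>

lemma card_less_normal_ctxts:
  fixes N :: "'a set"
  assumes inacc: "inaccessible |UNIV :: 'u set|" and N: "|N| <o |UNIV :: 'u set|"
  shows "|normal_ctxts N| <o |UNIV :: 'u set|"
proof (rule card_less_inj)
  let ?G = "\<lambda>X :: 'a emet. (\<lambda>(u, v). (u, v, edist X u v)) ` (N \<times> N)"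
  let ?c = "\<lambda>X :: 'a emet. (pts X, ?G X)"
  show "|Pow N \<times> Pow (N \<times> N \<times> (UNIV :: ennreal set))| <o |UNIV :: 'u set|"
    using inaccessible_Cinfinite[OF inacc] inaccessible_regularCard[OF inacc] N
      card_less_ennreal[OF inacc, of UNIV]
    by (intro card_less_Sigma card_less_Pow[OF inacc])
  show "?c ` normal_ctxts N \<subseteq> Pow N \<times> Pow (N \<times> N \<times> (UNIV :: ennreal set))"
    by (auto simp: normal_ctxts_def)
  show "inj_on ?c (normal_ctxts N)"
  proof (rule inj_onI)
    fix X Y assume X: "X \<in> normal_ctxts N" and Y: "Y \<in> normal_ctxts N" and eq: "?c X = ?c Y"
    have pts: "pts X = pts Y"
      using eq by simp
    have "edist X u v = edist Y u v" for u v
    proof (cases "u \<in> pts X \<and> v \<in> pts X")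
      case True
      then have "u \<in> N" "v \<in> N"
        using X by (auto simp: normal_ctxts_def)
      then have "(u, v, edist X u v) \<in> ?G X"
        by auto
      then have "(u, v, edist X u v) \<in> ?G Y"
        using eq by simp
      then show ?thesis by auto
    next
      case False
      then show ?thesis
        using X Y pts by (simp add: normal_ctxts_def)
    qed
    then show "X = Y"
      using pts by (intro emet.equality) auto
  qed
qed

lemma satisfies_rename:
  assumes g: "inj_on g (pts X)" and pq: "p \<in> terms \<Sigma> (pts X)" "q \<in> terms \<Sigma> (pts X)"
  shows "satisfies \<Sigma> A \<lparr>ctxt = met_transport g X, lhs = rename \<Sigma> g p, rhs = rename \<Sigma> g q, bnd = \<epsilon>\<rparr>
    \<longleftrightarrow> satisfies \<Sigma> A \<lparr>ctxt = X, lhs = p, rhs = q, bnd = \<epsilon>\<rparr>" (is "?L \<longleftrightarrow> ?R")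
proof
  assume L: ?L
  show ?R
    unfolding satisfies_def
  proof
    fix a assume "a \<in> met_hom (ctxt \<lparr>ctxt = X, lhs = p, rhs = q, bnd = \<epsilon>\<rparr>) (U0 A)"
    then have a: "a \<in> met_hom X (U0 A)"
      by simp
    define b where "b = compose (g ` pts X) a (restrict (inv_into (pts X) g) (g ` pts X))"
    have b: "b \<in> met_hom (met_transport g X) (U0 A)"
      using met_hom_compose[OF met_transport_inv_hom[OF g] a] by (simp add: b_def)
    have "interp \<Sigma> A (\<lambda>v. b (g v)) t = interp \<Sigma> A a t" if "t \<in> terms \<Sigma> (pts X)" for t
      using that g by (intro interp_cong[of "pts X"]) (simp_all add: b_def compose_eq)
    then show "edist (U0 A) (interp \<Sigma> A a (lhs \<lparr>ctxt = X, lhs = p, rhs = q, bnd = \<epsilon>\<rparr>))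
        (interp \<Sigma> A a (rhs \<lparr>ctxt = X, lhs = p, rhs = q, bnd = \<epsilon>\<rparr>))
      \<le> ennreal (bnd \<lparr>ctxt = X, lhs = p, rhs = q, bnd = \<epsilon>\<rparr>)"
      using satisfiesD[OF L, of b] b pq by (simp add: interp_rename)
  qed
next
  assume R: ?R
  let ?e = "\<lparr>ctxt = met_transport g X, lhs = rename \<Sigma> g p, rhs = rename \<Sigma> g q, bnd = \<epsilon>\<rparr>"
  show ?L
    unfolding satisfies_def
  proof
    fix b assume "b \<in> met_hom (ctxt ?e) (U0 A)"
    then have b: "b \<in> met_hom (met_transport g X) (U0 A)"
      by simp
    define a where "a = compose (pts X) b (restrict g (pts X))"
    have a: "a \<in> met_hom X (U0 A)"
      unfolding a_def using met_hom_compose[OF met_transport_hom[OF g] b] .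
    have "interp \<Sigma> A (\<lambda>v. b (g v)) t = interp \<Sigma> A a t" if "t \<in> terms \<Sigma> (pts X)" for t
      using that by (intro interp_cong[of "pts X"]) (simp_all add: a_def compose_eq)
    then show "edist (U0 A) (interp \<Sigma> A b (lhs ?e)) (interp \<Sigma> A b (rhs ?e)) \<le> ennreal (bnd ?e)"
      using satisfiesD[OF R, of a] a pq by (simp add: interp_rename)
  qed
qed

text \<open>All equations of the class whose context is normalised with points in \<open>N\<close>;
  a small \<open>N\<close> makes this a set.\<close>

definition theory_of ::
  "'m rel \<Rightarrow> 's signature \<Rightarrow> 'u set \<Rightarrow> ('s, 'u) qalg set \<Rightarrow> ('s, 'u) qeq set" where
  "theory_of \<mu> \<Sigma> N \<K> = {e. ctxt e \<in> normal_ctxts N \<and> mu_basic \<mu> \<Sigma> e \<and> (\<forall>A\<in>\<K>. satisfies \<Sigma> A e)}"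

lemma mu_basic_theory_theory_of:
  fixes N :: "'u set"
  assumes inacc: "inaccessible |UNIV :: 'u set|" and N: "|N| <o |UNIV :: 'u set|"
    and syms: "|syms \<Sigma>| <o |UNIV :: 'u set|"
  shows "mu_basic_theory \<mu> \<Sigma> (theory_of \<mu> \<Sigma> N \<K>)"
  unfolding mu_basic_theory_def
proof
  show "|theory_of \<mu> \<Sigma> N \<K>| <o |UNIV :: 'u set|"
  proof (rule card_less_inj)
    show "inj_on (\<lambda>e. (ctxt e, lhs e, rhs e, bnd e)) (theory_of \<mu> \<Sigma> N \<K>)"
      by (auto intro!: inj_onI qeq.equality)
    show "(\<lambda>e. (ctxt e, lhs e, rhs e, bnd e)) ` theory_of \<mu> \<Sigma> N \<K> \<subseteq>
        normal_ctxts N \<times> terms \<Sigma> N \<times> terms \<Sigma> N \<times> UNIV"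
      by (auto simp: theory_of_def normal_ctxts_def mu_basic_def intro: terms_mono)
    show "|normal_ctxts N \<times> terms \<Sigma> N \<times> terms \<Sigma> N \<times> (UNIV :: real set)| <o |UNIV :: 'u set|"
      using inaccessible_Cinfinite[OF inacc] inaccessible_regularCard[OF inacc]
        card_less_normal_ctxts[OF inacc N] card_less_terms[OF inacc syms N]
        card_less_real[OF inacc, of UNIV]
      by (intro card_less_Sigma)
  qed
qed (simp add: theory_of_def)

text \<open>Contexts are countable, so every one of them can be renamed into the infinite set
  \<open>N\<close>. The type of variables is arbitrary because the lemma is applied to coproducts of
  contexts, whose points are pairs.\<close>

lemma theory_of_complete:
  fixes N :: "'u set" and X :: "'v emet"
  assumes mu: "\<mu> =o natLeq \<or> \<mu> =o cardSuc natLeq" and N: "infinite N"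
    and B: "B \<in> models \<Sigma> (theory_of \<mu> \<Sigma> N \<K>)"
    and X: "emetric X" "|pts X| <o \<mu>"
    and pq: "p \<in> terms \<Sigma> (pts X)" "q \<in> terms \<Sigma> (pts X)" and "0 \<le> \<epsilon>"
    and \<K>: "\<And>A. A \<in> \<K> \<Longrightarrow> satisfies \<Sigma> A \<lparr>ctxt = X, lhs = p, rhs = q, bnd = \<epsilon>\<rparr>"
  shows "satisfies \<Sigma> B \<lparr>ctxt = X, lhs = p, rhs = q, bnd = \<epsilon>\<rparr>"
proof -
  obtain k :: "'v \<Rightarrow> nat" where k: "inj_on k (pts X)"
    using omega_or_omega1_countable[OF mu X(2)] by (auto simp: countable_def)
  obtain \<iota> :: "nat \<Rightarrow> 'u" where \<iota>: "inj \<iota>" "range \<iota> \<subseteq> N"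
    using infinite_countable_subset[OF N] by blast
  define g where "g = \<iota> \<circ> k"
  have g: "inj_on g (pts X)" "g ` pts X \<subseteq> N"
    using k \<iota> by (auto simp: g_def intro!: comp_inj_on inj_on_subset[of \<iota> UNIV])
  let ?e = "\<lparr>ctxt = met_transport g X, lhs = rename \<Sigma> g p, rhs = rename \<Sigma> g q, bnd = \<epsilon>\<rparr>"
  have "mu_basic \<mu> \<Sigma> ?e"
    using X g(1) pq \<open>0 \<le> \<epsilon>\<close>
    by (auto simp: mu_basic_def intro!: emetric_transport card_less_image rename_terms)
  then have "?e \<in> theory_of \<mu> \<Sigma> N \<K>"
    using \<K> X(1) g pq by (simp add: theory_of_def met_transport_normal_ctxts satisfies_rename)
  then show ?thesis
    using B g pq by (simp add: models_def flip: satisfies_rename)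
qed

section \<open>Algebras generated by a coproduct of contexts\<close>

definition met_sum :: "'i set \<Rightarrow> ('i \<Rightarrow> 'a emet) \<Rightarrow> ('i \<times> 'a) emet" where
  "met_sum I X = \<lparr>pts = (SIGMA i:I. pts (X i)),
     edist = (\<lambda>(i, x) (j, y). if i = j then edist (X i) x y else \<infinity>)\<rparr>"

lemma pts_met_sum [simp]: "pts (met_sum I X) = (SIGMA i:I. pts (X i))"
  by (simp add: met_sum_def)

lemma edist_met_sum [simp]:
  "edist (met_sum I X) (i, x) (j, y) = (if i = j then edist (X i) x y else \<infinity>)"
  by (simp add: met_sum_def)

lemma emetric_met_sum:
  assumes "\<And>i. i \<in> I \<Longrightarrow> emetric (X i)"
  shows "emetric (met_sum I X)"
  unfolding emetric_def
  using emetricD[OF assms] by (auto split: if_splits)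

lemma met_sum_homI:
  assumes "\<And>i. i \<in> I \<Longrightarrow> (\<lambda>x\<in>pts (X i). h (i, x)) \<in> met_hom (X i) Y"
  shows "restrict h (SIGMA i:I. pts (X i)) \<in> met_hom (met_sum I X) Y"
proof (rule met_homI)
  fix p assume "p \<in> pts (met_sum I X)"
  then show "restrict h (SIGMA i:I. pts (X i)) p \<in> pts Y"
    using met_hom_pts[OF assms] by fastforce
next
  fix p q assume "p \<in> pts (met_sum I X)" "q \<in> pts (met_sum I X)"
  then obtain i x j y where "p = (i, x)" "i \<in> I" "x \<in> pts (X i)" "q = (j, y)" "j \<in> I" "y \<in> pts (X j)"
    by auto
  then show "edist Y (restrict h (SIGMA i:I. pts (X i)) p) (restrict h (SIGMA i:I. pts (X i)) q)
      \<le> edist (met_sum I X) p q"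
    using met_hom_nonexpanding[OF assms[of i], of x y] by auto
qed simp

lemma met_sum_hom_component:
  assumes "h \<in> met_hom (met_sum I X) Y" "i \<in> I"
  shows "(\<lambda>x\<in>pts (X i). h (i, x)) \<in> met_hom (X i) Y"
proof (rule met_homI)
  fix x y assume "x \<in> pts (X i)" "y \<in> pts (X i)"
  then show "edist Y ((\<lambda>x\<in>pts (X i). h (i, x)) x) ((\<lambda>x\<in>pts (X i). h (i, x)) y) \<le> edist (X i) x y"
    using met_hom_nonexpanding[OF assms(1), of "(i, x)" "(i, y)"] assms(2) by simp
qed (use met_hom_pts[OF assms(1)] assms(2) in auto)

text \<open>The components outside \<open>J\<close> are collapsed to a single point, for which the
  target must be nonempty; their infinite distance from the others keeps the map
  nonexpanding.\<close>

lemma met_sum_hom_extend: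
  assumes "J \<subseteq> I" "a \<in> met_hom (met_sum J X) Y" "emetric Y" "pts Y \<noteq> {}"
  obtains b where "b \<in> met_hom (met_sum I X) Y"
    "\<And>v. v \<in> (SIGMA i:J. pts (X i)) \<Longrightarrow> b v = a v"
proof -
  obtain y where y: "y \<in> pts Y"
    using assms(4) by blast
  define b where "b = restrict (\<lambda>(i, x). if i \<in> J then a (i, x) else y) (SIGMA i:I. pts (X i))"
  have "b \<in> met_hom (met_sum I X) Y"
    unfolding b_def
  proof (rule met_sum_homI)
    fix i assume "i \<in> I"
    show "(\<lambda>x\<in>pts (X i). case (i, x) of (i, x) \<Rightarrow> if i \<in> J then a (i, x) else y) \<in> met_hom (X i) Y"
    proof (cases "i \<in> J")
      case True
      then show ?thesis
        using met_sum_hom_component[OF assms(2) True] by simp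
    next
      case False
      have "edist Y y y = 0"
        using emetric_eq_0_iff[OF assms(3)] y by simp
      then show ?thesis
        using y False by (intro met_homI) auto
    qed
  qed
  moreover have "b v = a v" if "v \<in> (SIGMA i:J. pts (X i))" for v
    using that assms(1) by (auto simp: b_def)
  ultimately show thesis
    by (rule that)
qed

text \<open>Every point of \<open>F\<close> is the value of a term. Terms with the same value in
  \<open>F\<close> are at distance 0 there, hence by \<open>le\<close> also in \<open>B\<close>, so
  the value in \<open>B\<close> does not depend on the chosen term; \<open>le\<close> also makes the
  resulting map nonexpanding.\<close>

lemma generated_extension:
  assumes F: "qalgebra \<Sigma> F" "pts (U0 F) = interp \<Sigma> F \<alpha> ` terms \<Sigma> V"
    and B: "qalgebra \<Sigma> B" "\<And>v. v \<in> V \<Longrightarrow> \<beta> v \<in> pts (U0 B)"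
    and le: "\<And>p q. \<lbrakk>p \<in> terms \<Sigma> V; q \<in> terms \<Sigma> V\<rbrakk> \<Longrightarrow>
      edist (U0 B) (interp \<Sigma> B \<beta> p) (interp \<Sigma> B \<beta> q) \<le> edist (U0 F) (interp \<Sigma> F \<alpha> p) (interp \<Sigma> F \<alpha> q)"
  obtains f where "f \<in> alg_hom \<Sigma> F B"
    "\<And>t. t \<in> terms \<Sigma> V \<Longrightarrow> f (interp \<Sigma> F \<alpha> t) = interp \<Sigma> B \<beta> t"
proof -
  have B_pts: "interp \<Sigma> B \<beta> t \<in> pts (U0 B)" if "t \<in> terms \<Sigma> V" for t
    using B(2) that by (rule interp_pts[OF B(1)])
  have wd: "interp \<Sigma> B \<beta> p = interp \<Sigma> B \<beta> q"
    if pq: "p \<in> terms \<Sigma> V" "q \<in> terms \<Sigma> V" and eq: "interp \<Sigma> F \<alpha> p = interp \<Sigma> F \<alpha> q" for p q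
  proof -
    have "edist (U0 F) (interp \<Sigma> F \<alpha> p) (interp \<Sigma> F \<alpha> q) = 0"
      using emetric_eq_0_iff[OF qalgebra_emetric[OF F(1)]] F(2) pq eq by simp
    then show ?thesis
      using le[OF pq] emetric_eq_0_iff[OF qalgebra_emetric[OF B(1)] B_pts B_pts] pq by simp
  qed
  define f where "f = (\<lambda>z\<in>pts (U0 F). interp \<Sigma> B \<beta> (SOME t. t \<in> terms \<Sigma> V \<and> interp \<Sigma> F \<alpha> t = z))"
  have f: "f (interp \<Sigma> F \<alpha> t) = interp \<Sigma> B \<beta> t" if t: "t \<in> terms \<Sigma> V" for t
  proof -
    let ?P = "\<lambda>s. s \<in> terms \<Sigma> V \<and> interp \<Sigma> F \<alpha> s = interp \<Sigma> F \<alpha> t"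
    have "?P (SOME s. ?P s)"
      by (rule someI[of _ t]) (use t in simp)
    then have "interp \<Sigma> B \<beta> (SOME s. ?P s) = interp \<Sigma> B \<beta> t"
      using wd t by blast
    then show ?thesis
      using t F(2) by (simp add: f_def)
  qed
  have "f \<in> alg_hom \<Sigma> F B"
  proof (rule alg_homI)
    show "f \<in> met_hom (U0 F) (U0 B)"
    proof (rule met_homI)
      fix x y assume "x \<in> pts (U0 F)" "y \<in> pts (U0 F)"
      then show "edist (U0 B) (f x) (f y) \<le> edist (U0 F) x y"
        using F(2) f le by auto
    next
      fix x assume "x \<in> pts (U0 F)"
      then show "f x \<in> pts (U0 B)"
        using F(2) f B_pts by auto
    qed (simp add: f_def)
    fix s a
    assume s: "s \<in> syms \<Sigma>" and a: "a \<in> idx (arity \<Sigma> s) \<rightarrow>\<^sub>E pts (U0 F)"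
    obtain ts where ts: "App s ts \<in> terms \<Sigma> V" "interp \<Sigma> F \<alpha> (App s ts) = opn F s a"
      "\<And>k. k \<in> idx (arity \<Sigma> s) \<Longrightarrow> ts k \<in> terms \<Sigma> V \<and> interp \<Sigma> F \<alpha> (ts k) = a k"
      using generated_subset_closed[OF F(1) s a[unfolded F(2)]] by blast
    have "f (a k) = interp \<Sigma> B \<beta> (ts k)" if "k \<in> idx (arity \<Sigma> s)" for k
      using ts(3)[OF that] f by metis
    then have "(\<lambda>k\<in>idx (arity \<Sigma> s). f (a k)) = (\<lambda>k\<in>idx (arity \<Sigma> s). interp \<Sigma> B \<beta> (ts k))"
      by (intro restrict_ext) simp
    then show "f (opn F s a) = opn B s (\<lambda>k\<in>idx (arity \<Sigma> s). f (a k))"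
      using f[OF ts(1)] ts(2) by simp
  qed
  then show thesis
    using that f by blast
qed

text \<open>Distances in a product are suprema over the factors, so a suitable family of assignments
  forces prescribed lower bounds on the distances between terms in \<open>F\<close>. The subalgebra
  generated by \<open>Y\<close> is taken so that maps out of \<open>F\<close> can be defined on
  terms.\<close>

lemma generated_subalgebra_of_product:
  fixes \<K> :: "('s, 'u) qalg set" and A :: "'j \<Rightarrow> ('s, 'u) qalg" and Y :: "'v emet"
  assumes inacc: "inaccessible |UNIV :: 'u set|" and \<K>: "surj_birkhoff \<Sigma> \<K>"
    and J: "|J| <o |UNIV :: 'u set|"
    and A: "\<And>j. j \<in> J \<Longrightarrow> A j \<in> \<K>" "\<And>j. j \<in> J \<Longrightarrow> a j \<in> met_hom Y (U0 (A j))"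
  obtains F \<alpha> where "F \<in> \<K>" "\<alpha> \<in> met_hom Y (U0 F)" "pts (U0 F) = interp \<Sigma> F \<alpha> ` terms \<Sigma> (pts Y)"
    "\<And>p q. \<lbrakk>p \<in> terms \<Sigma> (pts Y); q \<in> terms \<Sigma> (pts Y)\<rbrakk> \<Longrightarrow>
      edist (U0 F) (interp \<Sigma> F \<alpha> p) (interp \<Sigma> F \<alpha> q) =
        (SUP j\<in>J. edist (U0 (A j)) (interp \<Sigma> (A j) (a j) p) (interp \<Sigma> (A j) (a j) q))"
proof -
  \<comment> \<open>Closure under products is stated for index sets inside the universe type,
    whereas \<open>J\<close> will consist of triples of two terms and a rational.\<close>
  obtain code :: "'j \<Rightarrow> 'u" where code: "inj_on code J"
    using J by (rule card_less_inj_into_UNIV)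
  define I where "I = code ` J"
  define dec where "dec = inv_into J code"
  have dec: "dec i \<in> J" if "i \<in> I" for i
    using that code by (auto simp: I_def dec_def)
  have dec_I: "dec ` I = J"
    using code by (auto simp: I_def dec_def image_image)
  have small_I: "small I"
    unfolding small_def I_def using J by (rule card_less_image)
  have \<K>_Alg: "C \<in> Alg \<Sigma>" if "C \<in> \<K>" for C
    using \<K> that by (auto simp: surj_birkhoff_def)
  have A_alg: "qalgebra \<Sigma> (A (dec i))" if "i \<in> I" for i
    using \<K>_Alg[OF A(1)[OF dec[OF that]]] by (simp add: Alg_iff)
  define P\<^sub>0 where "P\<^sub>0 = alg_prod \<Sigma> I (\<lambda>i. A (dec i))"
  have P\<^sub>0: "qalgebra \<Sigma> P\<^sub>0"
    unfolding P\<^sub>0_def using A_alg by (rule qalgebra_alg_prod)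
  have U0_P\<^sub>0: "U0 P\<^sub>0 = met_prod I (\<lambda>i. U0 (A (dec i)))"
    by (simp add: P\<^sub>0_def)
  then have pts_P\<^sub>0: "pts (U0 P\<^sub>0) = (\<Pi>\<^sub>E i\<in>I. pts (U0 (A (dec i))))"
    by simp
  have small_P\<^sub>0: "|pts (U0 P\<^sub>0)| <o |UNIV :: 'u set|"
    unfolding pts_P\<^sub>0 using small_I \<K>_Alg[OF A(1)[OF dec]]
    by (intro card_less_PiE inacc) (simp_all add: Alg_iff small_def)
  \<comment> \<open>The product lives over a function type; being small, it has a copy
    \<open>P\<close> in the universe type, which belongs to the class.\<close>
  then obtain g :: "('u \<Rightarrow> 'u) \<Rightarrow> 'u" where g: "inj_on g (pts (U0 P\<^sub>0))"
    by (rule card_less_inj_into_UNIV)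
  define P where "P = alg_transport \<Sigma> g P\<^sub>0"
  have U0_P: "U0 P = met_transport g (U0 P\<^sub>0)"
    by (simp add: P_def)
  have P: "qalgebra \<Sigma> P"
    unfolding P_def by (rule qalgebra_alg_transport[OF P\<^sub>0 g])
  have P_Alg: "P \<in> Alg \<Sigma>"
    using P card_less_image[OF small_P\<^sub>0] by (simp add: Alg_iff P_def small_def)
  have "P \<in> \<K>"
  proof -
    have "closed_under_products \<Sigma> \<K>"
      using \<K> by (simp add: surj_birkhoff_def)
    moreover have "small I \<and> (\<forall>i\<in>I. A (dec i) \<in> \<K>)"
      using small_I A(1)[OF dec] by blast
    moreover note P_Alg
    moreover have "alg_iso \<Sigma> (alg_prod \<Sigma> I (\<lambda>i. A (dec i))) P"
      using alg_iso_transport[OF P\<^sub>0 g] by (simp add: P_def P\<^sub>0_def)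
    ultimately show ?thesis
      by (rule closed_under_products_def[THEN iffD1, rule_format])
  qed
  define \<alpha>\<^sub>0 where "\<alpha>\<^sub>0 = (\<lambda>y\<in>pts Y. \<lambda>i\<in>I. a (dec i) y)"
  have \<alpha>\<^sub>0: "\<alpha>\<^sub>0 \<in> met_hom Y (U0 P\<^sub>0)"
  proof (rule met_homI)
    fix x y assume xy: "x \<in> pts Y" "y \<in> pts Y"
    show "\<alpha>\<^sub>0 x \<in> pts (U0 P\<^sub>0)"
      using xy(1) met_hom_pts[OF A(2)[OF dec]] by (simp add: \<alpha>\<^sub>0_def pts_P\<^sub>0)
    show "edist (U0 P\<^sub>0) (\<alpha>\<^sub>0 x) (\<alpha>\<^sub>0 y) \<le> edist Y x y"
      using xy met_hom_nonexpanding[OF A(2)[OF dec]]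
      by (auto simp: P\<^sub>0_def edist_met_prod \<alpha>\<^sub>0_def intro!: SUP_least)
  qed (simp add: \<alpha>\<^sub>0_def)
  have P\<^sub>0_pts: "interp \<Sigma> P\<^sub>0 \<alpha>\<^sub>0 t \<in> pts (U0 P\<^sub>0)" if "t \<in> terms \<Sigma> (pts Y)" for t
    using met_hom_pts[OF \<alpha>\<^sub>0] that by (rule interp_pts[OF P\<^sub>0])
  have P\<^sub>0_interp: "interp \<Sigma> P\<^sub>0 \<alpha>\<^sub>0 t i = interp \<Sigma> (A (dec i)) (a (dec i)) t"
    if i: "i \<in> I" and t: "t \<in> terms \<Sigma> (pts Y)" for i t
  proof -
    define \<pi> where "\<pi> = (\<lambda>x\<in>\<Pi>\<^sub>E i\<in>I. pts (U0 (A (dec i))). x i)"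
    have \<pi>: "\<pi> \<in> alg_hom \<Sigma> P\<^sub>0 (A (dec i))"
      unfolding \<pi>_def P\<^sub>0_def using i A_alg by (rule alg_prod_projection)
    have "\<pi> (interp \<Sigma> P\<^sub>0 \<alpha>\<^sub>0 t) = interp \<Sigma> (A (dec i)) (a (dec i)) t"
    proof (rule interp_hom[OF P\<^sub>0 \<pi>])
      show "\<alpha>\<^sub>0 y \<in> pts (U0 P\<^sub>0)" if "y \<in> pts Y" for y
        by (rule met_hom_pts[OF \<alpha>\<^sub>0 that])
      show "a (dec i) y = \<pi> (\<alpha>\<^sub>0 y)" if "y \<in> pts Y" for y
        using met_hom_pts[OF \<alpha>\<^sub>0 that] that i by (simp add: \<pi>_def pts_P\<^sub>0 \<alpha>\<^sub>0_def)
    qed (fact t)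
    then show ?thesis
      using P\<^sub>0_pts[OF t] by (simp add: \<pi>_def pts_P\<^sub>0)
  qed
  define \<alpha> where "\<alpha> = compose (pts Y) (restrict g (pts (U0 P\<^sub>0))) \<alpha>\<^sub>0"
  have gP: "restrict g (pts (U0 P\<^sub>0)) \<in> alg_hom \<Sigma> P\<^sub>0 P"
    unfolding P_def by (rule alg_transport_hom[OF P\<^sub>0 g])
  have \<alpha>P: "\<alpha> \<in> met_hom Y (U0 P)"
    unfolding \<alpha>_def by (rule met_hom_compose[OF \<alpha>\<^sub>0 alg_hom_met_hom[OF gP]])
  have P_interp: "interp \<Sigma> P \<alpha> t = g (interp \<Sigma> P\<^sub>0 \<alpha>\<^sub>0 t)" if t: "t \<in> terms \<Sigma> (pts Y)" for t
  proof -
    have "restrict g (pts (U0 P\<^sub>0)) (interp \<Sigma> P\<^sub>0 \<alpha>\<^sub>0 t) = interp \<Sigma> P \<alpha> t"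
      using met_hom_pts[OF \<alpha>\<^sub>0] t
      by (intro interp_hom[OF P\<^sub>0 gP, of "pts Y"]) (simp_all add: \<alpha>_def compose_eq)
    then show ?thesis
      using P\<^sub>0_pts[OF t] by simp
  qed
  have P_dist: "edist (U0 P) (interp \<Sigma> P \<alpha> p) (interp \<Sigma> P \<alpha> q) =
      (SUP j\<in>J. edist (U0 (A j)) (interp \<Sigma> (A j) (a j) p) (interp \<Sigma> (A j) (a j) q))"
    if pq: "p \<in> terms \<Sigma> (pts Y)" "q \<in> terms \<Sigma> (pts Y)" for p q
  proof -
    have "edist (U0 P) (interp \<Sigma> P \<alpha> p) (interp \<Sigma> P \<alpha> q) =
        edist (U0 P\<^sub>0) (interp \<Sigma> P\<^sub>0 \<alpha>\<^sub>0 p) (interp \<Sigma> P\<^sub>0 \<alpha>\<^sub>0 q)"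
      using edist_met_transport[OF g P\<^sub>0_pts[OF pq(1)] P\<^sub>0_pts[OF pq(2)]]
      by (simp add: P_interp pq U0_P)
    also have "\<dots> = (SUP i\<in>I. edist (U0 (A (dec i))) (interp \<Sigma> (A (dec i)) (a (dec i)) p)
        (interp \<Sigma> (A (dec i)) (a (dec i)) q))"
      using P\<^sub>0_interp pq by (simp add: U0_P\<^sub>0 edist_met_prod)
    also have "\<dots> = (SUP j\<in>dec ` I. edist (U0 (A j)) (interp \<Sigma> (A j) (a j) p) (interp \<Sigma> (A j) (a j) q))"
      by (simp add: image_image)
    finally show ?thesis
      by (simp only: dec_I)
  qed
  define S where "S = interp \<Sigma> P \<alpha> ` terms \<Sigma> (pts Y)"
  have S: "S \<subseteq> pts (U0 P)"
    unfolding S_def using met_hom_pts[OF \<alpha>P] by (auto intro: interp_pts[OF P])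
  have closed: "opn P f b \<in> S" if "f \<in> syms \<Sigma>" "b \<in> idx (arity \<Sigma> f) \<rightarrow>\<^sub>E S" for f b
    using generated_subset_closed[OF P that(1) that(2)[unfolded S_def]] by (metis S_def imageI)
  define F where "F = subalgebra \<Sigma> P S"
  have F: "qalgebra \<Sigma> F"
    unfolding F_def using S closed by (rule qalgebra_subalgebra[OF P])
  have U0_F: "U0 F = \<lparr>pts = S, edist = edist (U0 P)\<rparr>"
    by (simp add: F_def)
  then have pts_F: "pts (U0 F) = S"
    by simp
  have inc: "(\<lambda>x\<in>S. x) \<in> alg_hom \<Sigma> F P"
    unfolding F_def using S closed by (rule subalgebra_hom[OF P])
  have "isometry (U0 F) (U0 P) (\<lambda>x\<in>S. x)"
    unfolding F_def using S closed by (rule subalgebra_isometry[OF P])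
  moreover have "F \<in> Alg \<Sigma>"
    using F P_Alg by (simp add: Alg_iff pts_F small_def card_less_subset[OF S])
  moreover have "closed_under_inj_subalgebras \<Sigma> \<K>"
    using \<K> by (simp add: surj_birkhoff_def)
  ultimately have "F \<in> \<K>"
    using \<open>P \<in> \<K>\<close> inc unfolding closed_under_inj_subalgebras_def by blast
  have \<alpha>_S: "\<alpha> y \<in> S" if "y \<in> pts Y" for y
    unfolding S_def by (rule image_eqI[of _ _ "Var y"]) (use that in \<open>auto intro: terms.Var\<close>)
  have \<alpha>F: "\<alpha> \<in> met_hom Y (U0 F)"
    using met_hom_nonexpanding[OF \<alpha>P] \<alpha>_S met_hom_extensional[OF \<alpha>P]
    by (intro met_homI) (simp_all add: F_def)
  have F_interp: "interp \<Sigma> F \<alpha> t = interp \<Sigma> P \<alpha> t" if t: "t \<in> terms \<Sigma> (pts Y)" for t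
  proof -
    have "(\<lambda>x\<in>S. x) (interp \<Sigma> F \<alpha> t) = interp \<Sigma> P \<alpha> t"
      using t \<alpha>_S by (intro interp_hom[OF F inc, of "pts Y"]) (simp_all add: pts_F)
    moreover have "interp \<Sigma> F \<alpha> t \<in> S"
      using interp_pts[OF F met_hom_pts[OF \<alpha>F] t] by (simp add: pts_F)
    ultimately show ?thesis by simp
  qed
  show thesis
  proof (rule that[OF \<open>F \<in> \<K>\<close> \<alpha>F])
    show "pts (U0 F) = interp \<Sigma> F \<alpha> ` terms \<Sigma> (pts Y)"
      unfolding pts_F S_def using F_interp by (intro image_cong) simp_all
    show "edist (U0 F) (interp \<Sigma> F \<alpha> p) (interp \<Sigma> F \<alpha> q) =
        (SUP j\<in>J. edist (U0 (A j)) (interp \<Sigma> (A j) (a j) p) (interp \<Sigma> (A j) (a j) q))"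
      if "p \<in> terms \<Sigma> (pts Y)" "q \<in> terms \<Sigma> (pts Y)" for p q
      using P_dist[OF that] F_interp that by (simp add: U0_F)
  qed
qed

text \<open>
  Two terms over a coproduct of contexts involve less than \<open>\<mu>\<close> components.  An assignment on these
  components extends to the whole coproduct because distinct components are at distance \<open>\<infinity>\<close>.
\<close>

lemma theory_of_complete_sum:
  fixes N :: "'u set" and X :: "'i \<Rightarrow> 'v emet"
  assumes mu: "\<mu> =o natLeq \<or> \<mu> =o cardSuc natLeq" "mu_ary \<mu> \<Sigma>"
    and N: "infinite N" and \<K>: "\<K> \<subseteq> Alg \<Sigma>"
    and B: "B \<in> models \<Sigma> (theory_of \<mu> \<Sigma> N \<K>)"
    and X: "\<And>c. c \<in> C \<Longrightarrow> emetric (X c)" "\<And>c. c \<in> C \<Longrightarrow> |pts (X c)| <o \<mu>"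
    and \<beta>: "\<beta> \<in> met_hom (met_sum C X) (U0 B)"
    and pq: "p \<in> terms \<Sigma> (pts (met_sum C X))" "q \<in> terms \<Sigma> (pts (met_sum C X))"
    and "0 \<le> \<epsilon>"
    and far: "ennreal \<epsilon> < edist (U0 B) (interp \<Sigma> B \<beta> p) (interp \<Sigma> B \<beta> q)"
  obtains A a where "A \<in> \<K>" "a \<in> met_hom (met_sum C X) (U0 A)"
    "ennreal \<epsilon> < edist (U0 A) (interp \<Sigma> A a p) (interp \<Sigma> A a q)"
proof -
  note Cinf = omega_or_omega1_Cinfinite[OF mu(1)] and reg = omega_or_omega1_regularCard[OF mu(1)]
  define V where "V = vars \<Sigma> p \<union> vars \<Sigma> q"
  define D where "D = fst ` V"
  have "|V| <o \<mu>"
    unfolding V_def using Cinf reg mu(2) pq by (intro card_less_Un card_less_vars)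
  then have D_less: "|D| <o \<mu>"
    unfolding D_def by (rule card_less_image)
  have V_C: "V \<subseteq> (SIGMA c:C. pts (X c))"
    using vars_subset[OF pq(1)] vars_subset[OF pq(2)] by (simp add: V_def)
  then have D_C: "D \<subseteq> C"
    by (auto simp: D_def)
  define W where "W = met_sum D X"
  have "V \<subseteq> pts W"
    using V_C by (force simp: W_def D_def)
  then have pq_W: "p \<in> terms \<Sigma> (pts W)" "q \<in> terms \<Sigma> (pts W)"
    using terms_vars[OF pq(1)] terms_vars[OF pq(2)] by (simp_all add: V_def)
  \<comment> \<open>The components in which variables of \<open>p\<close> and \<open>q\<close> occur
    form a context again, by regularity of \<mu>.\<close>
  have W: "emetric W" "|pts W| <o \<mu>"
    unfolding W_def using X D_C D_less by (auto intro!: emetric_met_sum card_less_Sigma Cinf reg)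
  let ?e = "\<lparr>ctxt = W, lhs = p, rhs = q, bnd = \<epsilon>\<rparr>"
  define b where "b = restrict \<beta> (pts W)"
  have "b \<in> met_hom W (U0 B)"
  proof (rule met_homI)
    fix x y assume "x \<in> pts W" "y \<in> pts W"
    then show "edist (U0 B) (b x) (b y) \<le> edist W x y" "b x \<in> pts (U0 B)"
      using met_hom_nonexpanding[OF \<beta>, of x y] met_hom_pts[OF \<beta>, of x] D_C
      by (auto simp: b_def W_def met_sum_def)
  qed (simp add: b_def)
  moreover have "interp \<Sigma> B b t = interp \<Sigma> B \<beta> t" if "t \<in> terms \<Sigma> (pts W)" for t
    using that by (intro interp_cong[of "pts W"]) (simp_all add: b_def)
  ultimately have "\<not> satisfies \<Sigma> B ?e"
    using satisfiesD[of \<Sigma> B ?e b] far pq_W by (auto simp: not_le)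
  \<comment> \<open>If every member of the class satisfied this equation, then so would
    \<open>B\<close>, by completeness of the theory.\<close>
  then obtain A where A: "A \<in> \<K>" "\<not> satisfies \<Sigma> A ?e"
    using theory_of_complete[OF mu(1) N B W pq_W \<open>0 \<le> \<epsilon>\<close>] by blast
  then obtain a where a: "a \<in> met_hom W (U0 A)"
    and a_far: "ennreal \<epsilon> < edist (U0 A) (interp \<Sigma> A a p) (interp \<Sigma> A a q)"
    by (auto simp: satisfies_def not_le)
  have A_alg: "qalgebra \<Sigma> A"
    using A(1) \<K> by (auto simp: Alg_iff)
  \<comment> \<open>The value of \<open>p\<close> witnesses a nonempty carrier, which the extension
    of \<open>a\<close> to the remaining components requires. It exists even if \<open>p\<close> has
    no variables.\<close>
  have "interp \<Sigma> A a p \<in> pts (U0 A)"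
    using met_hom_pts[OF a] pq_W(1) by (rule interp_pts[OF A_alg])
  then have ne: "pts (U0 A) \<noteq> {}"
    by blast
  obtain a' where a': "a' \<in> met_hom (met_sum C X) (U0 A)"
    "\<And>v. v \<in> (SIGMA c:D. pts (X c)) \<Longrightarrow> a' v = a v"
    using met_sum_hom_extend[OF D_C a[unfolded W_def] qalgebra_emetric[OF A_alg] ne] by blast
  have "interp \<Sigma> A a' t = interp \<Sigma> A a t" if "t \<in> terms \<Sigma> (pts W)" for t
    using that a'(2) by (intro interp_cong[of "pts W"]) (simp_all add: W_def)
  then show thesis
    using that[OF A(1) a'(1)] a_far pq_W by simp
qed

text \<open>
  The product has one factor for each rational strict lower bound of a distance between two terms,
  which keeps it small although \<open>\<K>\<close> is a class.  A context over \<open>B\<close> lifts to \<open>F\<close> along the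
  corresponding coproduct injection.
\<close>

lemma models_theory_of_subset:
  fixes N :: "'u set"
  assumes inacc: "inaccessible |UNIV :: 'u set|"
    and mu: "\<mu> =o natLeq \<or> \<mu> =o cardSuc natLeq" "mu_ary \<mu> \<Sigma>"
    and syms: "|syms \<Sigma>| <o |UNIV :: 'u set|"
    and \<K>: "mu_surj_birkhoff \<mu> \<Sigma> \<K>"
    and N: "infinite N" "|N| <o |UNIV :: 'u set|"
    and B: "B \<in> models \<Sigma> (theory_of \<mu> \<Sigma> N \<K>)"
  shows "B \<in> \<K>"
proof -
  note Cinf = inaccessible_Cinfinite[OF inacc] and reg = inaccessible_regularCard[OF inacc]
  note mu_Cinf = omega_or_omega1_Cinfinite[OF mu(1)] and mu_reg = omega_or_omega1_regularCard[OF mu(1)]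
  have sb: "surj_birkhoff \<Sigma> \<K>" and \<K>_Alg: "\<K> \<subseteq> Alg \<Sigma>"
    using \<K> by (simp_all add: mu_surj_birkhoff_def surj_birkhoff_def)
  have B_Alg: "B \<in> Alg \<Sigma>" and B_alg: "qalgebra \<Sigma> B" and B_small: "|pts (U0 B)| <o |UNIV :: 'u set|"
    using B by (auto simp: models_def Alg_iff small_def)
  \<comment> \<open>Only normalised contexts over \<open>N\<close> are used, which keeps
    \<open>Y\<close> small; the others are reached by renaming.\<close>
  define C where "C = (SIGMA X:{X \<in> normal_ctxts N. |pts X| <o \<mu>}. met_hom X (U0 B))"
  define Y where "Y = met_sum C fst"
  have C: "emetric (fst c)" "|pts (fst c)| <o \<mu>" "pts (fst c) \<subseteq> N" "snd c \<in> met_hom (fst c) (U0 B)"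
    if "c \<in> C" for c
    using that by (auto simp: C_def normal_ctxts_def)
  have ctxt_small: "|pts X| <o |UNIV :: 'u set|" if "X \<in> normal_ctxts N" for X
    using that by (intro card_less_subset[OF _ N(2)]) (simp add: normal_ctxts_def)
  have hom_small: "|met_hom X (U0 B)| <o |UNIV :: 'u set|" if "X \<in> normal_ctxts N" for X
  proof (rule card_less_subset)
    show "met_hom X (U0 B) \<subseteq> pts X \<rightarrow>\<^sub>E pts (U0 B)"
      by (auto simp: met_hom_def)
    show "|pts X \<rightarrow>\<^sub>E pts (U0 B)| <o |UNIV :: 'u set|"
      by (intro card_less_PiE inacc ctxt_small that B_small)
  qed
  have "|{X \<in> normal_ctxts N. |pts X| <o \<mu>}| <o |UNIV :: 'u set|"
    by (rule card_less_subset[OF _ card_less_normal_ctxts[OF inacc N(2)]]) blast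
  then have C_small: "|C| <o |UNIV :: 'u set|"
    unfolding C_def using hom_small by (intro card_less_Sigma Cinf reg) auto
  have "|pts Y| <o |UNIV :: 'u set|"
    unfolding Y_def pts_met_sum using C_small C(3)
    by (intro card_less_Sigma Cinf reg card_less_subset[OF _ N(2)])
  then have terms_small: "|terms \<Sigma> (pts Y)| <o |UNIV :: 'u set|"
    by (rule card_less_terms[OF inacc syms])
  \<comment> \<open>The universal map out of the coproduct: on the component indexed by a map into
    \<open>B\<close> it is that map.\<close>
  define \<beta> where "\<beta> = restrict (\<lambda>(c, x). snd c x) (SIGMA c:C. pts (fst c))"
  have \<beta>: "\<beta> \<in> met_hom Y (U0 B)"
    unfolding \<beta>_def Y_def
  proof (rule met_sum_homI)
    fix c assume c: "c \<in> C"
    have "(\<lambda>x\<in>pts (fst c). case (c, x) of (c, x) \<Rightarrow> snd c x) = snd c"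
      using PiE_restrict[OF met_hom_PiE[OF C(4)[OF c]]] by simp
    then show "(\<lambda>x\<in>pts (fst c). case (c, x) of (c, x) \<Rightarrow> snd c x) \<in> met_hom (fst c) (U0 B)"
      using C(4)[OF c] by simp
  qed

  define separated where "separated p q r Aa \<longleftrightarrow> fst Aa \<in> \<K> \<and> snd Aa \<in> met_hom Y (U0 (fst Aa)) \<and>
      ennreal (real_of_rat r) < edist (U0 (fst Aa)) (interp \<Sigma> (fst Aa) (snd Aa) p) (interp \<Sigma> (fst Aa) (snd Aa) q)"
    for p q r Aa
  define J where "J = {(p, q, r). p \<in> terms \<Sigma> (pts Y) \<and> q \<in> terms \<Sigma> (pts Y) \<and> (\<exists>Aa. separated p q r Aa)}"
  define Aa where "Aa = (\<lambda>(p, q, r). SOME Aa. separated p q r Aa)"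
  have Aa: "separated p q r (Aa (p, q, r))" if "(p, q, r) \<in> J" for p q r
    using that by (auto simp: J_def Aa_def intro: someI_ex)
  have "|terms \<Sigma> (pts Y) \<times> terms \<Sigma> (pts Y) \<times> (UNIV :: rat set)| <o |UNIV :: 'u set|"
    using terms_small card_less_countable[OF inacc, of "UNIV :: rat set"]
    by (intro card_less_Sigma Cinf reg) auto
  then have J_small: "|J| <o |UNIV :: 'u set|"
    by (rule card_less_subset[rotated]) (auto simp: J_def)
  have Aa_\<K>: "fst (Aa j) \<in> \<K>" "snd (Aa j) \<in> met_hom Y (U0 (fst (Aa j)))" if "j \<in> J" for j
    using that Aa by (cases j; auto simp: separated_def)+
  obtain F \<alpha> where F: "F \<in> \<K>" "\<alpha> \<in> met_hom Y (U0 F)"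
    and F_gen: "pts (U0 F) = interp \<Sigma> F \<alpha> ` terms \<Sigma> (pts Y)"
    and F_dist: "\<And>p q. \<lbrakk>p \<in> terms \<Sigma> (pts Y); q \<in> terms \<Sigma> (pts Y)\<rbrakk> \<Longrightarrow>
      edist (U0 F) (interp \<Sigma> F \<alpha> p) (interp \<Sigma> F \<alpha> q) =
        (SUP j\<in>J. edist (U0 (fst (Aa j))) (interp \<Sigma> (fst (Aa j)) (snd (Aa j)) p)
          (interp \<Sigma> (fst (Aa j)) (snd (Aa j)) q))"
    using generated_subalgebra_of_product[OF inacc sb J_small, of "\<lambda>j. fst (Aa j)" "\<lambda>j. snd (Aa j)" Y]
      Aa_\<K> by blast
  have F_alg: "qalgebra \<Sigma> F"
    using F(1) \<K>_Alg by (auto simp: Alg_iff)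

  have le: "edist (U0 B) (interp \<Sigma> B \<beta> p) (interp \<Sigma> B \<beta> q) \<le> edist (U0 F) (interp \<Sigma> F \<alpha> p) (interp \<Sigma> F \<alpha> q)"
    if pq: "p \<in> terms \<Sigma> (pts Y)" "q \<in> terms \<Sigma> (pts Y)" for p q
  proof (rule ccontr)
    assume "\<not> ?thesis"
    \<comment> \<open>The equation with a bound \<open>r\<close> strictly between the two distances
      fails in \<open>B\<close>, hence in a member of the class. Then \<open>(p, q, r)\<close>
      indexes a factor of the product, and this factor forces the distance in \<open>F\<close> above
      \<open>r\<close>.\<close>
    then obtain r :: rat
      where r: "edist (U0 F) (interp \<Sigma> F \<alpha> p) (interp \<Sigma> F \<alpha> q) < ennreal (real_of_rat r)"
        "ennreal (real_of_rat r) < edist (U0 B) (interp \<Sigma> B \<beta> p) (interp \<Sigma> B \<beta> q)"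
      using ennreal_rat_dense by (auto simp: not_le)
    \<comment> \<open>A bound of an equation must not be negative. The rational exceeds some
      distance, whereas \<open>ennreal\<close> sends negative numbers to 0.\<close>
    have "0 \<le> real_of_rat r"
      using r(1) by (metis ennreal_neg linorder_le_cases not_less_zero)
    then obtain A a where "A \<in> \<K>" "a \<in> met_hom Y (U0 A)"
      "ennreal (real_of_rat r) < edist (U0 A) (interp \<Sigma> A a p) (interp \<Sigma> A a q)"
      using theory_of_complete_sum[OF mu N(1) \<K>_Alg B C(1,2) \<beta>[unfolded Y_def] pq[unfolded Y_def] _ r(2)]
      unfolding Y_def by blast
    then have "separated p q r (A, a)"
      by (simp add: separated_def)
    then have j: "(p, q, r) \<in> J"
      using pq by (auto simp: J_def)
    have "ennreal (real_of_rat r) < edist (U0 F) (interp \<Sigma> F \<alpha> p) (interp \<Sigma> F \<alpha> q)"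
      unfolding F_dist[OF pq] less_SUP_iff using Aa[OF j] j by (auto simp: separated_def)
    then show False
      using r(1) by simp
  qed
  obtain f where f: "f \<in> alg_hom \<Sigma> F B"
    and f_interp: "\<And>t. t \<in> terms \<Sigma> (pts Y) \<Longrightarrow> f (interp \<Sigma> F \<alpha> t) = interp \<Sigma> B \<beta> t"
    by (rule generated_extension[OF F_alg F_gen B_alg, of \<beta>]) (use met_hom_pts[OF \<beta>] le in blast)+

  have lift: "\<exists>g\<in>met_hom X (U0 F). compose (pts X) f g = h"
    if X: "emetric X" "|pts X| <o \<mu>" and h: "h \<in> met_hom X (U0 B)" for X :: "'u emet" and h
  proof -
    obtain k :: "'u \<Rightarrow> nat" where k: "inj_on k (pts X)"
      using omega_or_omega1_countable[OF mu(1) X(2)] by (auto simp: countable_def)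
    obtain \<iota> :: "nat \<Rightarrow> 'u" where \<iota>: "inj \<iota>" "range \<iota> \<subseteq> N"
      using infinite_countable_subset[OF N(1)] by blast
    define g where "g = \<iota> \<circ> k"
    have g: "inj_on g (pts X)" "g ` pts X \<subseteq> N"
      using k \<iota> by (auto simp: g_def intro!: comp_inj_on inj_on_subset[of \<iota> UNIV])
    define h' where "h' = compose (g ` pts X) h (restrict (inv_into (pts X) g) (g ` pts X))"
    define c where "c = (met_transport g X, h')"
    have "h' \<in> met_hom (met_transport g X) (U0 B)"
      using met_hom_compose[OF met_transport_inv_hom[OF g(1)] h] by (simp add: h'_def)
    then have c: "c \<in> C"
      using met_transport_normal_ctxts[OF X(1) g] card_less_image[OF X(2)] by (simp add: c_def C_def)
    \<comment> \<open>The lift is \<alpha> on the component of \<open>Y\<close> indexed by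
      \<open>h\<close> itself, up to renaming. Variables are terms, so \<open>f\<close> after
      \<alpha> agrees with \<beta>, which is \<open>h\<close> on this component.\<close>
    define l where "l = compose (pts X) (\<lambda>x\<in>pts (fst c). \<alpha> (c, x)) (restrict g (pts X))"
    have "(\<lambda>x\<in>pts (fst c). \<alpha> (c, x)) \<in> met_hom (fst c) (U0 F)"
      using F(2) c unfolding Y_def by (rule met_sum_hom_component)
    then have l: "l \<in> met_hom X (U0 F)"
      using met_hom_compose[OF met_transport_hom[OF g(1)]] by (simp add: l_def c_def)
    moreover have "compose (pts X) f l = h"
    proof (rule extensionalityI)
      fix x assume x: "x \<in> pts X"
      then have cx: "(c, g x) \<in> pts Y"
        using c by (simp add: Y_def c_def)
      have "f (l x) = f (interp \<Sigma> F \<alpha> (Var (c, g x)))"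
        using x by (simp add: l_def compose_eq c_def)
      also have "\<dots> = \<beta> (c, g x)"
        using f_interp[OF terms.Var[OF cx]] by simp
      also have "\<dots> = h x"
        using cx x g(1) by (simp add: \<beta>_def Y_def c_def h'_def compose_eq)
      finally show "compose (pts X) f l x = h x"
        using x by (simp add: compose_eq)
    qed (use met_hom_extensional[OF h] in auto)
    ultimately show ?thesis
      by blast
  qed
  have f_hom: "f \<in> met_hom (U0 F) (U0 B)"
    by (rule alg_hom_met_hom[OF f])
  have "b \<in> f ` pts (U0 F)" if b: "b \<in> pts (U0 B)" for b
  proof -
    \<comment> \<open>Surjectivity is the lifting of one-point contexts.\<close>
    let ?X = "\<lparr>pts = {b}, edist = edist (U0 B)\<rparr>"
    have "(\<lambda>x\<in>{b}. x) \<in> met_hom ?X (U0 B)"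
      using b by (intro met_homI) auto
    then obtain g where g: "g \<in> met_hom ?X (U0 F)" "compose {b} f g = (\<lambda>x\<in>{b}. x)"
      using lift[of ?X "\<lambda>x\<in>{b}. x"] b emetric_subset[OF qalgebra_emetric[OF B_alg], of "{b}"]
      by (auto simp: card_less_finite[OF mu_Cinf])
    have "f (g b) = b"
      using fun_cong[OF g(2), of b] by (simp add: compose_eq)
    then show ?thesis
      using met_hom_pts[OF g(1), of b] by (simp add: image_iff) metis
  qed
  then have "f ` pts (U0 F) = pts (U0 B)"
    using met_hom_pts[OF f_hom] by blast
  \<comment> \<open>Test spaces for purity are \<mu>-generated and so have fewer than \<mu> points;
    the lifting of contexts applies to them.\<close>
  moreover have "mu_pure_epi \<mu> (U0 F) (U0 B) f"
    unfolding mu_pure_epi_def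
    using f_hom lift mu_generated_imp_card_less[OF inacc mu_Cinf mu_reg]
    by (auto simp: mu_generated_def Met_def)
  moreover have "closed_under_pure_quotients \<mu> \<Sigma> \<K>"
    using \<K> by (simp add: mu_surj_birkhoff_def)
  ultimately show ?thesis
    using F(1) B_Alg f unfolding closed_under_pure_quotients_def by blast
qed

theorem corollary5p18:
  fixes \<mu> :: "'m rel"
    and \<Sigma> :: "'s signature"
    and \<K> :: "('s, 'u) qalg set"
  assumes "inaccessible |UNIV :: 'u set|"
    and "\<mu> =o natLeq \<or> \<mu> =o cardSuc natLeq"
    and "mu_ary \<mu> \<Sigma>"
    and "|syms \<Sigma>| <o |UNIV :: 'u set|"
    and "\<K> \<subseteq> Alg \<Sigma>"
  shows "mu_surj_birkhoff \<mu> \<Sigma> \<K> \<longleftrightarrow> (\<exists>T. mu_basic_theory \<mu> \<Sigma> T \<and> \<K> = models \<Sigma> T)"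
proof
  assume \<K>: "mu_surj_birkhoff \<mu> \<Sigma> \<K>"
  have "infinite (UNIV :: 'u set)"
    using inaccessible_Cinfinite[OF assms(1)] by (simp add: cinfinite_def Field_card_of)
  then obtain \<iota> :: "nat \<Rightarrow> 'u" where \<iota>: "inj \<iota>"
    using infinite_countable_subset by blast
  \<comment> \<open>A countably infinite supply of points suffices for the variables of all contexts
    and is small.\<close>
  define N where "N = range \<iota>"
  have N: "infinite N" "|N| <o |UNIV :: 'u set|"
    using \<iota> by (auto simp: N_def finite_image_iff intro!: card_less_countable assms(1))
  have "\<K> \<subseteq> models \<Sigma> (theory_of \<mu> \<Sigma> N \<K>)"
    using assms(5) by (auto simp: models_def theory_of_def)
  moreover have "models \<Sigma> (theory_of \<mu> \<Sigma> N \<K>) \<subseteq> \<K>"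
    using models_theory_of_subset[OF assms(1-4) \<K> N] by blast
  ultimately show "\<exists>T. mu_basic_theory \<mu> \<Sigma> T \<and> \<K> = models \<Sigma> T"
    using mu_basic_theory_theory_of[OF assms(1) N(2) assms(4)] by blast
next
  assume "\<exists>T. mu_basic_theory \<mu> \<Sigma> T \<and> \<K> = models \<Sigma> T"
  then show "mu_surj_birkhoff \<mu> \<Sigma> \<K>"
    using mu_surj_birkhoff_models[OF assms(1,2)] by blast
qed

end
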